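(* Let $G$ be a finite group and $k$ a commutative unitary ring in which $|G|$ is invertible. The elements $\varphi_{K,\kappa}^G$, indexed by $(K,\kappa)\in\mathcal{M}_{\Phi(G)}^G$, form a complete set of orthogonal idempotents in the algebra $\mathcal{E}(G)=\widetilde{e_G^G}\,B_k^{\mathbb{C}^\times}(G,G)\,\widetilde{e_G^G}$. That is: (1) $\varphi_{K,\kappa}^G\cdot\varphi_{L,\lambda}^G=\delta_{(K,\kappa),(L,\lambda)}\,\varphi_{K,\kappa}^G$ for all $(K,\kappa),(L,\lambda)\in\mathcal{M}_{\Phi(G)}^G$; (2) $\sum_{(K,\kappa)\in\mathcal{M}_{\Phi(G)}^G}\varphi_{K,\kappa}^G=\widetilde{e_G^G}$.
   Context: Fibered bisets. For a finite group $U$ write $U^*=\mathrm{Hom}(U,\mathbb{C}^\times)$. For finite groups $G,H$ let $\mathcal{M}_{G\times H}$ be the set of pairs $(U,\upsilon)$ with $U\le G\times H$, $\upsilon\in U^*$. A $\mathbb{C}^\times$-fibered $(G,H)$-biset is a $(\mathbb{C}^\times\times G\times H)$-set that is free over $\mathbb{C}^\times$ with finitely many $\mathbb{C}^\times$-orbits. Isomorphism classes of transitive ones ($G\times H$ transitive on $\mathbb{C}^\times$-orbits) correspond to $G\times H$-conjugacy classes of pairs $(U,\upsilon)\in\mathcal{M}_{G\times H}$ ($U$ is the stabilizer of an orbit $\mathbb{C}^\times x$ and $ux=\upsilon(u)x$); the class is denoted $\left[\frac{G\times H}{U,\upsilon}\right]$. $B_k^{\mathbb{C}^\times}(G,H)$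 is the free $k$-module on these classes. With $p_1(U),p_2(U)$ the projections of $U$, $k_1(U)=\{g:(g,1)\in U\}$, $k_2(U)=\{h:(1,h)\in U\}$, $\upsilon_1(g)=\upsilon(g,1)$ on $k_1(U)$, $\upsilon_2(h)=\upsilon(1,h)^{-1}$ on $k_2(U)$, the bilinear composition $B_k^{\mathbb{C}^\times}(G,H)\times B_k^{\mathbb{C}^\times}(H,L)\to B_k^{\mathbb{C}^\times}(G,L)$ is \[\left[\tfrac{G\times H}{U,\upsilon}\right]\left[\tfrac{H\times L}{V,\omega}\right]=\sum_{t}\left[\tfrac{G\times L}{U*{}^{(t,1)}V,\ \upsilon*{}^{(t,1)}\omega}\right],\] the sum over those $t\in p_2(U)\backslash H/p_1(V)$ for which $\upsilon_2$ and ${}^t\omega_1$ agree on $k_2(U)\cap{}^tk_1(V)$; here $U*V=\{(g,l):\exists h,\ (g,h)\in U,(h,l)\in V\}$ and $(\upsilon*\omega)(g,l)=\upsilon(g,h)\omega(h,l)$. This makes $B_k^{\mathbb{C}^\times}(G,G)$ a $k$-algebra with identity $\left[\frac{G\times G}{\Delta(G),1}\right]$, where $\Delta(X)=\{(x,x):x\in X\}$. Idempotents. $\widetilde{e_G^G}=\tfrac1{|G|}\sum_{X\le G}|X|\mu(X,G)\left[\tfrac{G\times G}{\Delta(X),1}\right]$ (an idempotent), $\mu$ the Möbius function of the subgroup poset of $G$. $\mathcal{M}_{\Phi(G)}^G$ is the set of pairs $(K,\kappa)$ with $K\unlhd G$, $K\le\Phi(G)$ (Frattini subgroup) and $\kappa\in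 K^*$ $G$-invariant, ordered by $(K,\kappa)\le(L,\lambda)$ iff $K\le L$ and $\lambda|_K=\kappa$. For such a pair, $e^G_{(L,\lambda)}=\left[\frac{G\times G}{\Delta_L(G),\phi_\lambda}\right]$ with $\Delta_L(G)=\{(g,h):gL=hL\}$, $\phi_\lambda(g,h)=\lambda(h^{-1}g)$, and \[\varphi_{K,\kappa}^G=\sum_{(K,\kappa)\le(L,\lambda)\in\mathcal{M}_{\Phi(G)}^G}\mu_{\unlhd G}(K,L)\ \widetilde{e_G^G}\,e_{(L,\lambda)}^G\,\widetilde{e_G^G},\] where $\mu_{\unlhd G}$ is the Möbius function of the poset of normal subgroups of $G$. *)

theory Defs
  imports "HOL-Algebra.Coset" "HOL-Library.Poly_Mapping" Complex_Main
begin

section \<open>Pairs of a subgroup and a linear character\<close>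

definition Cx :: "complex monoid" where
  "Cx = \<lparr>carrier = UNIV - {0}, monoid.mult = (*), one = 1\<rparr>"

text \<open>Characters of a subgroup \<open>U\<close> are extensional, so that equality of functions is
  equality of characters.\<close>

definition dual :: "('a, 'm) monoid_scheme \<Rightarrow> 'a set \<Rightarrow> ('a \<Rightarrow> complex) set" where
  "dual G U = hom (G\<lparr>carrier := U\<rparr>) Cx \<inter> extensional U"

definition char_pairs :: "('a, 'm) monoid_scheme \<Rightarrow> ('a set \<times> ('a \<Rightarrow> complex)) set" where
  "char_pairs G = {(U, \<upsilon>). subgroup U G \<and> \<upsilon> \<in> dual G U}"

definition conj_set :: "('a, 'm) monoid_scheme \<Rightarrow> 'a \<Rightarrow> 'a set \<Rightarrow> 'a set" where
  "conj_set G x U = (\<lambda>u. x \<otimes>\<^bsub>G\<^esub> u \<otimes>\<^bsub>G\<^esub> inv\<^bsub>G\<^esub> x) ` U"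

definition conj_char ::
  "('a, 'm) monoid_scheme \<Rightarrow> 'a \<Rightarrow> 'a set \<Rightarrow> ('a \<Rightarrow> complex) \<Rightarrow> 'a \<Rightarrow> complex" where
  "conj_char G x U \<upsilon> = (\<lambda>y \<in> conj_set G x U. \<upsilon> (inv\<^bsub>G\<^esub> x \<otimes>\<^bsub>G\<^esub> y \<otimes>\<^bsub>G\<^esub> x))"

section \<open>The free module on transitive fibered bisets\<close>

text \<open>The isomorphism class of the transitive fibered \<open>(G,H)\<close>-biset given by \<open>(U,\<upsilon>)\<close> is
  represented by the \<open>G \<times> H\<close>-conjugacy class of that pair.\<close>

type_synonym ('a, 'b) fib_class = "(('a \<times> 'b) set \<times> ('a \<times> 'b \<Rightarrow> complex)) set"

definition fib_class ::
  "('a, 'm) monoid_scheme \<Rightarrow> ('b, 'n) monoid_scheme \<Rightarrow> ('a \<times> 'b) set \<Rightarrow> ('a \<times> 'b \<Rightarrow> complex)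
    \<Rightarrow> ('a, 'b) fib_class" where
  "fib_class G H U \<upsilon> =
     {(conj_set (G \<times>\<times> H) x U, conj_char (G \<times>\<times> H) x U \<upsilon>) | x. x \<in> carrier (G \<times>\<times> H)}"

definition fib_classes ::
  "('a, 'm) monoid_scheme \<Rightarrow> ('b, 'n) monoid_scheme \<Rightarrow> ('a, 'b) fib_class set" where
  "fib_classes G H = {fib_class G H U \<upsilon> | U \<upsilon>. (U, \<upsilon>) \<in> char_pairs (G \<times>\<times> H)}"

text \<open>The coefficient sort is that of commutative rings with unit; unlike \<open>comm_ring_1\<close> it
  does not exclude the zero ring.\<close>

definition fib_module ::
  "('a, 'm) monoid_scheme \<Rightarrow> ('b, 'n) monoid_scheme
    \<Rightarrow> (('a, 'b) fib_class \<Rightarrow>\<^sub>0 'k::{comm_ring,comm_monoid_mult}) set" where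
  "fib_module G H = {f. Poly_Mapping.keys f \<subseteq> fib_classes G H}"

definition fib_basis ::
  "('a, 'm) monoid_scheme \<Rightarrow> ('b, 'n) monoid_scheme \<Rightarrow> ('a \<times> 'b) set \<Rightarrow> ('a \<times> 'b \<Rightarrow> complex)
    \<Rightarrow> (('a, 'b) fib_class \<Rightarrow>\<^sub>0 'k::{comm_ring,comm_monoid_mult})" where
  "fib_basis G H U \<upsilon> = Poly_Mapping.single (fib_class G H U \<upsilon>) 1"

definition scale ::
  "'k::{comm_ring,comm_monoid_mult} \<Rightarrow> ('c \<Rightarrow>\<^sub>0 'k) \<Rightarrow> ('c \<Rightarrow>\<^sub>0 'k)" where
  "scale a f = Poly_Mapping.map ((*) a) f"

text \<open>\<open>of_int\<close> is only available for rings with \<open>0 \<noteq> 1\<close>.\<close>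

definition int_embed :: "int \<Rightarrow> 'k::{comm_ring,comm_monoid_mult}" where
  "int_embed n = (\<Sum>i<nat n. 1) - (\<Sum>i<nat (- n). 1)"

section \<open>Composition\<close>

definition p1 :: "('a \<times> 'b) set \<Rightarrow> 'a set" where "p1 U = fst ` U"
definition p2 :: "('a \<times> 'b) set \<Rightarrow> 'b set" where "p2 U = snd ` U"

definition k1 :: "('b, 'n) monoid_scheme \<Rightarrow> ('a \<times> 'b) set \<Rightarrow> 'a set" where
  "k1 H U = {g. (g, \<one>\<^bsub>H\<^esub>) \<in> U}"

definition k2 :: "('a, 'm) monoid_scheme \<Rightarrow> ('a \<times> 'b) set \<Rightarrow> 'b set" where
  "k2 G U = {h. (\<one>\<^bsub>G\<^esub>, h) \<in> U}"

definition char1 ::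
  "('b, 'n) monoid_scheme \<Rightarrow> ('a \<times> 'b) set \<Rightarrow> ('a \<times> 'b \<Rightarrow> complex) \<Rightarrow> 'a \<Rightarrow> complex" where
  "char1 H U \<upsilon> = (\<lambda>g \<in> k1 H U. \<upsilon> (g, \<one>\<^bsub>H\<^esub>))"

definition char2 ::
  "('a, 'm) monoid_scheme \<Rightarrow> ('a \<times> 'b) set \<Rightarrow> ('a \<times> 'b \<Rightarrow> complex) \<Rightarrow> 'b \<Rightarrow> complex" where
  "char2 G U \<upsilon> = (\<lambda>h \<in> k2 G U. inverse (\<upsilon> (\<one>\<^bsub>G\<^esub>, h)))"

text \<open>The subgroup \<open>U * V\<close> is the relational composition \<open>U O V\<close>. The value below does not
  depend on the chosen \<open>h\<close> when \<open>char2\<close> of \<open>\<upsilon>\<close> and \<open>char1\<close> of \<open>\<omega>\<close> agree on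
  \<open>k2 U \<inter> k1 V\<close>.\<close>

definition star_char ::
  "('a \<times> 'b) set \<Rightarrow> ('a \<times> 'b \<Rightarrow> complex) \<Rightarrow> ('b \<times> 'c) set \<Rightarrow> ('b \<times> 'c \<Rightarrow> complex)
    \<Rightarrow> 'a \<times> 'c \<Rightarrow> complex" where
  "star_char U \<upsilon> V \<omega> = (\<lambda>(g, l) \<in> U O V.
     let h = (SOME h. (g, h) \<in> U \<and> (h, l) \<in> V) in \<upsilon> (g, h) * \<omega> (h, l))"

definition double_cosets :: "('a, 'm) monoid_scheme \<Rightarrow> 'a set \<Rightarrow> 'a set \<Rightarrow> 'a set set" where
  "double_cosets H P Q = {P <#>\<^bsub>H\<^esub> (t <#\<^bsub>H\<^esub> Q) | t. t \<in> carrier H}"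

definition double_coset_reps :: "('a, 'm) monoid_scheme \<Rightarrow> 'a set \<Rightarrow> 'a set \<Rightarrow> 'a set" where
  "double_coset_reps H P Q = (\<lambda>D. SOME t. t \<in> D) ` double_cosets H P Q"

definition compatible ::
  "('a, 'm) monoid_scheme \<Rightarrow> ('b, 'n) monoid_scheme \<Rightarrow> ('c, 'o) monoid_scheme
    \<Rightarrow> ('a \<times> 'b) set \<Rightarrow> ('a \<times> 'b \<Rightarrow> complex) \<Rightarrow> ('b \<times> 'c) set \<Rightarrow> ('b \<times> 'c \<Rightarrow> complex)
    \<Rightarrow> 'b \<Rightarrow> bool" where
  "compatible G H L U \<upsilon> V \<omega> t \<longleftrightarrow>
     (\<forall>h \<in> k2 G U \<inter> conj_set H t (k1 L V).
        char2 G U \<upsilon> h = conj_char H t (k1 L V) (char1 L V \<omega>) h)"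

definition pair_comp ::
  "('a, 'm) monoid_scheme \<Rightarrow> ('b, 'n) monoid_scheme \<Rightarrow> ('c, 'o) monoid_scheme
    \<Rightarrow> ('a \<times> 'b) set \<Rightarrow> ('a \<times> 'b \<Rightarrow> complex) \<Rightarrow> ('b \<times> 'c) set \<Rightarrow> ('b \<times> 'c \<Rightarrow> complex)
    \<Rightarrow> (('a, 'c) fib_class \<Rightarrow>\<^sub>0 'k::{comm_ring,comm_monoid_mult})" where
  "pair_comp G H L U \<upsilon> V \<omega> =
     (\<Sum>t \<in> {t \<in> double_coset_reps H (p2 U) (p1 V). compatible G H L U \<upsilon> V \<omega> t}.
        let V' = conj_set (H \<times>\<times> L) (t, \<one>\<^bsub>L\<^esub>) V;
            \<omega>' = conj_char (H \<times>\<times> L) (t, \<one>\<^bsub>L\<^esub>) V \<omega>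
        in fib_basis G L (U O V') (star_char U \<upsilon> V' \<omega>'))"

text \<open>Bilinear extension. The value of \<open>pair_comp\<close> only depends on the conjugacy classes of
  the two pairs, so representatives may be chosen.\<close>

definition fib_comp ::
  "('a, 'm) monoid_scheme \<Rightarrow> ('b, 'n) monoid_scheme \<Rightarrow> ('c, 'o) monoid_scheme
    \<Rightarrow> (('a, 'b) fib_class \<Rightarrow>\<^sub>0 'k::{comm_ring,comm_monoid_mult}) \<Rightarrow> (('b, 'c) fib_class \<Rightarrow>\<^sub>0 'k)
    \<Rightarrow> (('a, 'c) fib_class \<Rightarrow>\<^sub>0 'k)" where
  "fib_comp G H L a b =
     (\<Sum>c \<in> Poly_Mapping.keys a. \<Sum>d \<in> Poly_Mapping.keys b.
        let (U, \<upsilon>) = (SOME p. p \<in> c); (V, \<omega>) = (SOME q. q \<in> d)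
        in scale (Poly_Mapping.lookup a c * Poly_Mapping.lookup b d) (pair_comp G H L U \<upsilon> V \<omega>))"

abbreviation fib_mult ::
  "('a, 'm) monoid_scheme \<Rightarrow> (('a, 'a) fib_class \<Rightarrow>\<^sub>0 'k::{comm_ring,comm_monoid_mult})
    \<Rightarrow> (('a, 'a) fib_class \<Rightarrow>\<^sub>0 'k) \<Rightarrow> (('a, 'a) fib_class \<Rightarrow>\<^sub>0 'k)" where
  "fib_mult G \<equiv> fib_comp G G G"

section \<open>Moebius functions and the Frattini subgroup\<close>

text \<open>Moebius function of a poset \<open>P\<close> of finite sets ordered by inclusion; the finiteness test
  only serves termination.\<close>

function moebius :: "'a set set \<Rightarrow> 'a set \<Rightarrow> 'a set \<Rightarrow> int" where
  "moebius P X Y =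
     (if X = Y then 1
      else if X \<subset> Y \<and> finite Y then - (\<Sum>Z \<in> {Z \<in> P. X \<subseteq> Z \<and> Z \<subset> Y}. moebius P X Z)
      else 0)"
  by pat_completeness auto
termination
  by (relation "measure (\<lambda>(P, X, Y). card Y)") (auto intro: psubset_card_mono)

declare moebius.simps [simp del]

definition mu_sub :: "('a, 'm) monoid_scheme \<Rightarrow> 'a set \<Rightarrow> 'a set \<Rightarrow> int" where
  "mu_sub G = moebius {X. subgroup X G}"

definition mu_normal :: "('a, 'm) monoid_scheme \<Rightarrow> 'a set \<Rightarrow> 'a set \<Rightarrow> int" where
  "mu_normal G = moebius {N. N \<lhd> G}"

definition maximal_subgroup :: "('a, 'm) monoid_scheme \<Rightarrow> 'a set \<Rightarrow> bool" where
  "maximal_subgroup G M \<longleftrightarrow> subgroup M G \<and> M \<noteq> carrier G \<and>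
     (\<forall>N. subgroup N G \<and> M \<subseteq> N \<longrightarrow> N = M \<or> N = carrier G)"

definition frattini :: "('a, 'm) monoid_scheme \<Rightarrow> 'a set" where
  "frattini G = carrier G \<inter> \<Inter> {M. maximal_subgroup G M}"

section \<open>The idempotents\<close>

definition diag :: "'a set \<Rightarrow> ('a \<times> 'a) set" where
  "diag X = {(x, x) | x. x \<in> X}"

definition inv_order :: "('a, 'm) monoid_scheme \<Rightarrow> 'k::{comm_ring,comm_monoid_mult}" where
  "inv_order G = (THE c. c * int_embed (int (order G)) = 1)"

definition e_tilde ::
  "('a, 'm) monoid_scheme \<Rightarrow> (('a, 'a) fib_class \<Rightarrow>\<^sub>0 'k::{comm_ring,comm_monoid_mult})" where
  "e_tilde G = scale (inv_order G)
     (\<Sum>X \<in> {X. subgroup X G}.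
        scale (int_embed (int (card X) * mu_sub G X (carrier G)))
          (fib_basis G G (diag X) (\<lambda>u \<in> diag X. 1)))"

definition frattini_pairs :: "('a, 'm) monoid_scheme \<Rightarrow> ('a set \<times> ('a \<Rightarrow> complex)) set" where
  "frattini_pairs G = {(K, \<kappa>). K \<lhd> G \<and> K \<subseteq> frattini G \<and> \<kappa> \<in> dual G K \<and>
     (\<forall>g \<in> carrier G. conj_char G g K \<kappa> = \<kappa>)}"

definition pair_le ::
  "'a set \<times> ('a \<Rightarrow> complex) \<Rightarrow> 'a set \<times> ('a \<Rightarrow> complex) \<Rightarrow> bool" where
  "pair_le p q \<longleftrightarrow> fst p \<subseteq> fst q \<and> restrict (snd q) (fst p) = snd p"

definition diag_mod :: "('a, 'm) monoid_scheme \<Rightarrow> 'a set \<Rightarrow> ('a \<times> 'a) set" where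
  "diag_mod G L =
     {(g, h). g \<in> carrier G \<and> h \<in> carrier G \<and> g <#\<^bsub>G\<^esub> L = h <#\<^bsub>G\<^esub> L}"

definition e_pair ::
  "('a, 'm) monoid_scheme \<Rightarrow> 'a set \<times> ('a \<Rightarrow> complex)
    \<Rightarrow> (('a, 'a) fib_class \<Rightarrow>\<^sub>0 'k::{comm_ring,comm_monoid_mult})" where
  "e_pair G = (\<lambda>(L, \<Lambda>). fib_basis G G (diag_mod G L)
     (\<lambda>(g, h) \<in> diag_mod G L. \<Lambda> (inv\<^bsub>G\<^esub> h \<otimes>\<^bsub>G\<^esub> g)))"

definition phi ::
  "('a, 'm) monoid_scheme \<Rightarrow> 'a set \<times> ('a \<Rightarrow> complex)
    \<Rightarrow> (('a, 'a) fib_class \<Rightarrow>\<^sub>0 'k::{comm_ring,comm_monoid_mult})" where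
  "phi G p = (\<Sum>q \<in> {q \<in> frattini_pairs G. pair_le p q}.
     scale (int_embed (mu_normal G (fst p) (fst q)))
       (fib_mult G (fib_mult G (e_tilde G) (e_pair G q)) (e_tilde G)))"

definition E_algebra ::
  "('a, 'm) monoid_scheme \<Rightarrow> (('a, 'a) fib_class \<Rightarrow>\<^sub>0 'k::{comm_ring,comm_monoid_mult}) set" where
  "E_algebra G = {fib_mult G (fib_mult G (e_tilde G) b) (e_tilde G) | b. b \<in> fib_module G G}"

end

theory Submission
  imports Defs "HOL-Algebra.SndIsomorphismGrp" "HOL-Algebra.Multiplicative_Group"
begin

text \<open>The chain Phi(G) \<subseteq> X with K \<subseteq> Phi(G) is what closes the family under
  composition: if (g, h) lies over X and (h, l) over Y, then g lies in Y because K \<subseteq> Y,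
  and l lies in X because L \<subseteq> X, so the composite lives over the full intersection.
  Normality of K and G-invariance of kappa have a second effect: the compatibility test and the join
  of p and q do not depend on the double coset. Hence either every double coset contributes or none
  does, and the summand at w depends on X only through its meet with the conjugate of Y by w. This
  is the shape to which Weisner's theorem applies, for each w separately, since conjugates of a
  proper subgroup are proper. For Y = G all |G| values of w give the same term, which is where the
  factor 1/|G| in \<open>A p\<close> is consumed. The weights |X| and |Y| absorb the sizes of the
  double cosets, so that nothing but |G| has to be inverted in the coefficient ring.\<close>

text \<open>
  Write \<open>[X, K, \<kappa>]\<close> for the class of \<open>{(g, h) \<in> X \<times> X. gK = hK}\<close> with the character
  \<open>(g, h) \<mapsto> \<kappa> (h\<inverse> g)\<close>, where \<open>K \<subseteq> \<Phi>(G) \<subseteq> X\<close>. The elements \<open>|X| [X, p]\<close> multiply by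
  \<open>|X| [X, p] \<cdot> |Y| [Y, q] = \<Sum>w\<in>G. |X \<inter> wYw\<inverse>| [X \<inter> wYw\<inverse>, p \<squnion> q]\<close>, or to \<open>0\<close> if the
  characters of \<open>p\<close> and \<open>q\<close> disagree on the intersection of their domains.

  Since \<open>\<mu>(X, G) = 0\<close> unless \<open>\<Phi>(G) \<subseteq> X\<close>, the idempotent \<open>e_tilde\<close> is the element \<open>A (1, 1)\<close> of
  the family \<open>A p = (1 / |G|) \<Sum>X. \<mu>(X, G) |X| [X, p]\<close>. Weisner's theorem kills all terms with
  \<open>Y \<noteq> G\<close> in \<open>A p \<cdot> |Y| [Y, q]\<close>, so that \<open>A p \<cdot> A q = A (p \<squnion> q)\<close> and
  \<open>e_tilde \<cdot> e_pair q \<cdot> e_tilde = A q\<close>. The \<open>phi p\<close> are the Moebius inverses of the \<open>A q\<close>, that is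
  \<open>A p = \<Sum>r\<ge>p. phi r\<close>, because intervals of pairs are intervals of normal subgroups; they are
  therefore the orthogonal idempotents of a semilattice algebra.
\<close>

subsection \<open>Linear algebra over the coefficient ring\<close>

lemma int_embed_0 [simp]: "int_embed 0 = 0"
  by (simp add: int_embed_def)

text \<open>Exactly one of the two unit sums in \<open>int_embed\<close> changes its length,
  depending on the sign of n. This step drives the two-sided integer inductions behind the ring
  homomorphism laws.\<close>

lemma int_embed_add_1: "int_embed (n + 1) = int_embed n + 1"
proof (cases "n \<ge> 0")
  case True
  then have "nat (n + 1) = Suc (nat n)" "nat (- n) = 0" "nat (- (n + 1)) = 0" by simp_all
  then show ?thesis by (simp add: int_embed_def add.commute)
next
  case False
  then have "nat (- n) = Suc (nat (- (n + 1)))" "nat n = 0" "nat (n + 1) = 0" by simp_all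
  then show ?thesis by (simp add: int_embed_def del: minus_add_distrib)
qed

lemma int_embed_1 [simp]: "int_embed 1 = 1"
  using int_embed_add_1[of 0] by simp

lemma int_embed_diff_1: "int_embed (n - 1) = int_embed n - 1"
  by (metis add_diff_cancel diff_add_cancel int_embed_add_1)

lemma int_embed_add: "int_embed (m + n) = int_embed m + int_embed n"
proof (induction n rule: int_induct[where k = 0])
  case base then show ?case by simp
next
  case (step1 i)
  then show ?case by (metis add.assoc int_embed_add_1)
next
  case (step2 i)
  have "m + (i - 1) = (m + i) - 1" by simp
  with step2 show ?case by (simp only: int_embed_diff_1 add_diff_eq)
qed

lemma int_embed_uminus: "int_embed (- n) = - int_embed n"
  using int_embed_add[of n "- n"] by (simp add: eq_neg_iff_add_eq_0 add.commute)

lemma int_embed_mult: "int_embed (m * n) = int_embed m * int_embed n"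
proof (induction n rule: int_induct[where k = 0])
  case base then show ?case by simp
next
  case (step1 i)
  then show ?case by (simp add: int_embed_add distrib_left)
next
  case (step2 i)
  have "m * (i - 1) = m * i + - m" by (simp add: right_diff_distrib)
  with step2 show ?case
    by (simp only: int_embed_add int_embed_uminus int_embed_diff_1 right_diff_distrib) simp
qed

lemma int_embed_sum: "int_embed (sum f A) = (\<Sum>x\<in>A. int_embed (f x))"
  by (induction A rule: infinite_finite_induct) (simp_all add: int_embed_add)

lemma lookup_scale: "Poly_Mapping.lookup (scale a f) x = a * Poly_Mapping.lookup f x"
  by (simp add: scale_def Poly_Mapping.map.rep_eq when_def)

lemma keys_scale: "Poly_Mapping.keys (scale a f) \<subseteq> Poly_Mapping.keys f"
  by (auto simp: in_keys_iff lookup_scale)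

lemma scale_1 [simp]: "scale 1 f = f"
  by (rule poly_mapping_eqI) (simp add: lookup_scale)

lemma scale_0 [simp]: "scale 0 f = 0"
  by (rule poly_mapping_eqI) (simp add: lookup_scale)

lemma scale_zero [simp]: "scale a 0 = 0"
  by (rule poly_mapping_eqI) (simp add: lookup_scale)

lemma scale_scale: "scale a (scale b f) = scale (a * b) f"
  by (rule poly_mapping_eqI) (simp add: lookup_scale mult.assoc)

lemma scale_commute: "scale a (scale b f) = scale b (scale a f)"
  by (simp add: scale_scale mult.commute)

lemma scale_add: "scale a (f + g) = scale a f + scale a g"
  by (rule poly_mapping_eqI) (simp add: lookup_scale lookup_add distrib_left)

lemma scale_add_left: "scale (a + b) f = scale a f + scale b f"
  by (rule poly_mapping_eqI) (simp add: lookup_scale lookup_add distrib_right)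

lemma scale_sum: "scale a (sum f A) = (\<Sum>x\<in>A. scale a (f x))"
  by (induction A rule: infinite_finite_induct) (simp_all add: scale_add)

lemma scale_sum_left: "scale (sum c A) f = (\<Sum>x\<in>A. scale (c x) f)"
  by (induction A rule: infinite_finite_induct) (simp_all add: scale_add_left)

lemma sum_const_scale: "(\<Sum>x\<in>A. f) = scale (int_embed (int (card A))) f"
  by (induction A rule: infinite_finite_induct)
     (simp_all add: int_embed_add scale_add_left)

section \<open>Bilinearity of the composition\<close>

definition class_comp ::
  "('a, 'm) monoid_scheme \<Rightarrow> ('b, 'n) monoid_scheme \<Rightarrow> ('c, 'o) monoid_scheme
    \<Rightarrow> ('a, 'b) fib_class \<Rightarrow> ('b, 'c) fib_class
    \<Rightarrow> (('a, 'c) fib_class \<Rightarrow>\<^sub>0 'k::{comm_ring,comm_monoid_mult})" where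
  "class_comp G H L c d =
     (let (U, \<upsilon>) = (SOME p. p \<in> c); (V, \<omega>) = (SOME q. q \<in> d) in pair_comp G H L U \<upsilon> V \<omega>)"

text \<open>Terms outside the supports have coefficient zero. Enlarging the index sets lets
  \<open>a\<close>, \<open>a'\<close> and \<open>a + a'\<close> share one set although their
  supports differ, and bilinearity becomes distributivity.\<close>

lemma fib_comp_supersets:
  assumes "finite S" "finite T" "Poly_Mapping.keys a \<subseteq> S" "Poly_Mapping.keys b \<subseteq> T"
  shows "fib_comp G H L a b = (\<Sum>c\<in>S. \<Sum>d\<in>T.
    scale (Poly_Mapping.lookup a c * Poly_Mapping.lookup b d) (class_comp G H L c d))"
proof -
  have "fib_comp G H L a b = (\<Sum>c\<in>Poly_Mapping.keys a. \<Sum>d\<in>Poly_Mapping.keys b.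
    scale (Poly_Mapping.lookup a c * Poly_Mapping.lookup b d) (class_comp G H L c d))"
    unfolding fib_comp_def class_comp_def
    by (intro sum.cong refl) (simp add: case_prod_beta Let_def)
  also have "\<dots> = (\<Sum>c\<in>Poly_Mapping.keys a. \<Sum>d\<in>T.
    scale (Poly_Mapping.lookup a c * Poly_Mapping.lookup b d) (class_comp G H L c d))"
    using assms by (intro sum.cong refl sum.mono_neutral_left) (auto simp: in_keys_iff)
  also have "\<dots> = (\<Sum>c\<in>S. \<Sum>d\<in>T.
    scale (Poly_Mapping.lookup a c * Poly_Mapping.lookup b d) (class_comp G H L c d))"
    using assms by (intro sum.mono_neutral_left) (auto simp: in_keys_iff)
  finally show ?thesis .
qed

lemma fib_comp_add_left: "fib_comp G H L (a + a') b = fib_comp G H L a b + fib_comp G H L a' b"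
proof -
  let ?S = "Poly_Mapping.keys a \<union> Poly_Mapping.keys a'"
  have *: "finite ?S" "finite (Poly_Mapping.keys b)" by simp_all
  show ?thesis
    using Poly_Mapping.keys_add[of a a']
    by (simp add: fib_comp_supersets[OF *] lookup_add distrib_right scale_add_left sum.distrib)
qed

lemma fib_comp_add_right: "fib_comp G H L a (b + b') = fib_comp G H L a b + fib_comp G H L a b'"
proof -
  let ?S = "Poly_Mapping.keys b \<union> Poly_Mapping.keys b'"
  have *: "finite (Poly_Mapping.keys a)" "finite ?S" by simp_all
  show ?thesis
    using Poly_Mapping.keys_add[of b b']
    by (simp add: fib_comp_supersets[OF *] lookup_add distrib_left scale_add_left sum.distrib)
qed

lemma fib_comp_scale_left: "fib_comp G H L (scale r a) b = scale r (fib_comp G H L a b)"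
proof -
  have *: "finite (Poly_Mapping.keys a)" "finite (Poly_Mapping.keys b)" by simp_all
  show ?thesis
    using keys_scale[of r a]
    by (simp add: fib_comp_supersets[OF *] lookup_scale scale_sum scale_scale mult.assoc)
qed

lemma fib_comp_scale_right: "fib_comp G H L a (scale r b) = scale r (fib_comp G H L a b)"
proof -
  have *: "finite (Poly_Mapping.keys a)" "finite (Poly_Mapping.keys b)" by simp_all
  show ?thesis
    using keys_scale[of r b]
    by (simp add: fib_comp_supersets[OF *] lookup_scale scale_sum scale_scale mult.left_commute)
qed

lemma fib_comp_zero_left [simp]: "fib_comp G H L 0 b = 0"
  by (simp add: fib_comp_def)

lemma fib_comp_zero_right [simp]: "fib_comp G H L a 0 = 0"
  by (simp add: fib_comp_def)

lemma fib_comp_sum_left: "fib_comp G H L (sum f A) b = (\<Sum>x\<in>A. fib_comp G H L (f x) b)"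
  by (induction A rule: infinite_finite_induct) (simp_all add: fib_comp_add_left)

lemma fib_comp_sum_right: "fib_comp G H L a (sum f A) = (\<Sum>x\<in>A. fib_comp G H L a (f x))"
  by (induction A rule: infinite_finite_induct) (simp_all add: fib_comp_add_right)

lemma fib_comp_single:
  "fib_comp G H L (Poly_Mapping.single c 1) (Poly_Mapping.single d 1) = class_comp G H L c d"
  by (simp add: fib_comp_supersets[of "{c}" "{d}"] keys_single)

subsection \<open>Moebius functions of finite set systems\<close>

lemma moebius_self [simp]: "moebius P X X = 1"
  by (simp add: moebius.simps)

lemma moebius_sum_left:
  assumes "finite P" "X \<in> P" "Y \<in> P" "finite Y" "X \<subseteq> Y"
  shows "(\<Sum>Z\<in>{Z \<in> P. X \<subseteq> Z \<and> Z \<subseteq> Y}. moebius P X Z) = (if X = Y then 1 else 0)"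
proof (cases "X = Y")
  case True
  then have "{Z \<in> P. X \<subseteq> Z \<and> Z \<subseteq> Y} = {X}" using assms by auto
  then show ?thesis using True by simp
next
  case False
  have "{Z \<in> P. X \<subseteq> Z \<and> Z \<subseteq> Y} = insert Y {Z \<in> P. X \<subseteq> Z \<and> Z \<subset> Y}"
    using assms by auto
  then show ?thesis
    using False assms by (simp add: moebius.simps[of P X Y] psubset_eq)
qed

text \<open>The recursion of \<open>moebius\<close> only controls sums over the second argument. For
  the first argument, the double sum of moebius(X, W) * moebius(Z, Y) over X \<subseteq> W
  \<subseteq> Z \<subseteq> Y is evaluated in both orders, with induction on the length of the
  interval.\<close>

lemma moebius_sum_right:
  assumes "finite P" "X \<in> P" "Y \<in> P" "finite Y" "X \<subseteq> Y"
  shows "(\<Sum>Z\<in>{Z \<in> P. X \<subseteq> Z \<and> Z \<subseteq> Y}. moebius P Z Y) = (if X = Y then 1 else 0)"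
  using assms(2,5)
proof (induction "card Y - card X" arbitrary: X rule: less_induct)
  case less
  define I where "I X' = {Z \<in> P. X' \<subseteq> Z \<and> Z \<subseteq> Y}" for X'
  have fin: "finite (I W)" for W using assms(1) by (simp add: I_def)
  show ?case
  proof (cases "X = Y")
    case True
    then have "{Z \<in> P. X \<subseteq> Z \<and> Z \<subseteq> Y} = {Y}" using assms by auto
    then show ?thesis using True by simp
  next
    case False
    have IH: "(\<Sum>Z\<in>I W. moebius P Z Y) = (if W = Y then 1 else 0)" if "W \<in> I X" "W \<noteq> X" for W
    proof -
      have "card X < card W" "card W \<le> card Y"
        using that assms(4) by (auto simp: I_def intro!: psubset_card_mono card_mono
            intro: finite_subset)
      then show ?thesis using less.hyps[of W] that by (simp add: I_def)
    qed
    have XI: "X \<in> I X" and YI: "Y \<in> I X - {X}" using less.prems assms False by (auto simp: I_def)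
    \<comment> \<open>The indicator of Z = X is about to be replaced by the sum of moebius(X, W)
      over W between X and Z.\<close>
    have "moebius P X Y = (\<Sum>Z\<in>I X. if Z = X then moebius P Z Y else 0)"
      using XI fin by simp
    also have "\<dots> = (\<Sum>Z\<in>I X. (\<Sum>W\<in>{W \<in> P. X \<subseteq> W \<and> W \<subseteq> Z}. moebius P X W) * moebius P Z Y)"
      using assms less.prems
      by (intro sum.cong refl, subst moebius_sum_left) (auto simp: I_def intro: finite_subset)
    also have "\<dots> = (\<Sum>Z\<in>I X. \<Sum>W\<in>{W \<in> P. X \<subseteq> W \<and> W \<subseteq> Z}. moebius P X W * moebius P Z Y)"
      by (simp add: sum_distrib_right)
    also have "\<dots> = (\<Sum>(Z, W)\<in>Sigma (I X) (\<lambda>Z. {W \<in> P. X \<subseteq> W \<and> W \<subseteq> Z}).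
        moebius P X W * moebius P Z Y)"
      using assms fin by (subst sum.Sigma) auto
    also have "\<dots> = (\<Sum>(W, Z)\<in>Sigma (I X) I. moebius P X W * moebius P Z Y)"
      by (rule sum.reindex_bij_witness[of _ "\<lambda>(x, y). (y, x)" "\<lambda>(x, y). (y, x)"])
         (force simp: I_def)+
    also have "\<dots> = (\<Sum>W\<in>I X. moebius P X W * (\<Sum>Z\<in>I W. moebius P Z Y))"
      using fin by (simp add: sum.Sigma sum_distrib_left)
    \<comment> \<open>The term W = X is the sum in question. By induction, of the others only W = Y
      survives; it equals the left-hand side and cancels.\<close>
    also have "\<dots> = (\<Sum>Z\<in>I X. moebius P Z Y) +
        (\<Sum>W\<in>I X - {X}. moebius P X W * (if W = Y then 1 else 0))"
      using XI fin by (subst sum.remove[of "I X" X]) (auto intro!: sum.cong simp: IH)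
    also have "(\<Sum>W\<in>I X - {X}. moebius P X W * (if W = Y then 1 else 0)) = moebius P X Y"
      using YI fin by (simp add: if_distrib[of "times _"] sum.delta cong: if_cong)
    finally show ?thesis using False by (simp add: I_def)
  qed
qed

text \<open>The dual of Weisner's theorem.\<close>

lemma moebius_sum_meet_fiber:
  assumes "finite P" "T \<in> P" "finite T" "\<And>X. X \<in> P \<Longrightarrow> X \<subseteq> T"
    and "\<And>X Y. X \<in> P \<Longrightarrow> Y \<in> P \<Longrightarrow> X \<inter> Y \<in> P"
    and "Z \<in> P" "Z \<noteq> T" "W \<in> P" "W \<subseteq> Z"
  shows "(\<Sum>X\<in>{X \<in> P. X \<inter> Z = W}. moebius P X T) = 0"
  using assms(8,9)
proof (induction "card Z - card W" arbitrary: W rule: less_induct)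
  case less
  let ?J = "{V \<in> P. W \<subseteq> V \<and> V \<subseteq> Z}"
  have WT: "W \<noteq> T" using less.prems assms(4,6,7) by blast
  have fin: "finite ?J" using assms by simp
  \<comment> \<open>The vanishing sum over the interval from W to T is split by the value V of the
    meet with Z. Fibres with V strictly above W vanish by induction, which leaves the fibre of
    W.\<close>
  have "0 = (\<Sum>X\<in>{X \<in> P. W \<subseteq> X \<and> X \<subseteq> T}. moebius P X T)"
    using moebius_sum_right[of P W T] assms(1-4) less.prems WT by auto
  also have "\<dots> = (\<Sum>V\<in>?J. \<Sum>X\<in>{X \<in> {X \<in> P. W \<subseteq> X \<and> X \<subseteq> T}. X \<inter> Z = V}. moebius P X T)"
    using assms(1,5,6) less.prems by (intro sum.group[symmetric]) auto
  also have "\<dots> = (\<Sum>V\<in>?J. \<Sum>X\<in>{X \<in> P. X \<inter> Z = V}. moebius P X T)"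
    using assms(4) by (intro sum.cong refl) auto
  also have "\<dots> = (\<Sum>V\<in>?J. if V = W then \<Sum>X\<in>{X \<in> P. X \<inter> Z = V}. moebius P X T else 0)"
  proof (intro sum.cong refl)
    fix V assume V: "V \<in> ?J"
    show "(\<Sum>X\<in>{X \<in> P. X \<inter> Z = V}. moebius P X T) =
      (if V = W then \<Sum>X\<in>{X \<in> P. X \<inter> Z = V}. moebius P X T else 0)"
    proof (cases "V = W")
      case False
      have "finite Z" using assms(3) assms(4)[OF assms(6)] finite_subset by blast
      then have "card W < card V" "card V \<le> card Z"
        using V False by (auto intro!: psubset_card_mono card_mono intro: finite_subset)
      then show ?thesis using less.hyps[of V] V False by simp
    qed simp
  qed
  also have "\<dots> = (\<Sum>X\<in>{X \<in> P. X \<inter> Z = W}. moebius P X T)"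
    using fin less.prems by simp
  finally show ?case by simp
qed

text \<open>On each fibre of X \<mapsto> X \<inter> Z the value of F is constant and the Moebius
  coefficients add up to zero. F will be a weighted class, with Z a conjugate of a proper
  subgroup.\<close>

lemma moebius_sum_meet:
  fixes F :: "'a set \<Rightarrow> ('c \<Rightarrow>\<^sub>0 'k::{comm_ring,comm_monoid_mult})"
  assumes "finite P" "T \<in> P" "finite T" "\<And>X. X \<in> P \<Longrightarrow> X \<subseteq> T"
    and "\<And>X Y. X \<in> P \<Longrightarrow> Y \<in> P \<Longrightarrow> X \<inter> Y \<in> P"
    and "Z \<in> P" "Z \<noteq> T"
  shows "(\<Sum>X\<in>P. scale (int_embed (moebius P X T)) (F (X \<inter> Z))) = 0"
proof -
  have "(\<Sum>X\<in>P. scale (int_embed (moebius P X T)) (F (X \<inter> Z))) =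
    (\<Sum>W\<in>{W \<in> P. W \<subseteq> Z}. \<Sum>X\<in>{X \<in> P. X \<inter> Z = W}. scale (int_embed (moebius P X T)) (F (X \<inter> Z)))"
    using assms by (intro sum.group[symmetric]) auto
  also have "\<dots> = (\<Sum>W\<in>{W \<in> P. W \<subseteq> Z}.
      scale (int_embed (\<Sum>X\<in>{X \<in> P. X \<inter> Z = W}. moebius P X T)) (F W))"
    by (intro sum.cong refl) (simp add: int_embed_sum scale_sum_left)
  also have "\<dots> = 0"
    using moebius_sum_meet_fiber[OF assms] by (intro sum.neutral) simp
  finally show ?thesis .
qed

subsection \<open>Conjugation, double cosets and the Frattini subgroup\<close>

definition conj_elt :: "('a, 'm) monoid_scheme \<Rightarrow> 'a \<Rightarrow> 'a \<Rightarrow> 'a" where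
  "conj_elt G x g = x \<otimes>\<^bsub>G\<^esub> g \<otimes>\<^bsub>G\<^esub> inv\<^bsub>G\<^esub> x"

lemma conj_set_conj_elt: "conj_set G x U = conj_elt G x ` U"
  by (simp add: conj_set_def conj_elt_def)

context group begin

lemma inv_cancel_left [simp]:
  assumes "x \<in> carrier G" "y \<in> carrier G"
  shows "inv x \<otimes> (x \<otimes> y) = y" "x \<otimes> (inv x \<otimes> y) = y"
  using assms by (simp_all flip: m_assoc)

lemma conj_elt_closed [simp]: "x \<in> carrier G \<Longrightarrow> g \<in> carrier G \<Longrightarrow> conj_elt G x g \<in> carrier G"
  by (simp add: conj_elt_def)

lemma conj_elt_conj_elt: "\<lbrakk>x \<in> carrier G; y \<in> carrier G; g \<in> carrier G\<rbrakk>
    \<Longrightarrow> conj_elt G x (conj_elt G y g) = conj_elt G (x \<otimes> y) g"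
  by (simp add: conj_elt_def m_assoc inv_mult_group)

lemma conj_elt_one [simp]: "g \<in> carrier G \<Longrightarrow> conj_elt G \<one> g = g"
  by (simp add: conj_elt_def)

lemma conj_elt_of_one [simp]: "x \<in> carrier G \<Longrightarrow> conj_elt G x \<one> = \<one>"
  by (simp add: conj_elt_def)

lemma conj_elt_mult: "\<lbrakk>x \<in> carrier G; g \<in> carrier G; h \<in> carrier G\<rbrakk>
    \<Longrightarrow> conj_elt G x (g \<otimes> h) = conj_elt G x g \<otimes> conj_elt G x h"
  by (simp add: conj_elt_def m_assoc)

lemma conj_elt_inv: "\<lbrakk>x \<in> carrier G; g \<in> carrier G\<rbrakk> \<Longrightarrow> conj_elt G x (inv g) = inv (conj_elt G x g)"
  by (simp add: conj_elt_def m_assoc inv_mult_group)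

lemma conj_elt_cancel [simp]:
  assumes "x \<in> carrier G" "g \<in> carrier G"
  shows "conj_elt G x (conj_elt G (inv x) g) = g" "conj_elt G (inv x) (conj_elt G x g) = g"
  using assms by (simp_all add: conj_elt_conj_elt)

lemma inj_on_conj_elt: "x \<in> carrier G \<Longrightarrow> inj_on (conj_elt G x) (carrier G)"
  by (rule inj_on_inverseI[of _ "conj_elt G (inv x)"]) simp

lemma mem_conj_set_iff:
  assumes "x \<in> carrier G" "U \<subseteq> carrier G" "g \<in> carrier G"
  shows "g \<in> conj_set G x U \<longleftrightarrow> conj_elt G (inv x) g \<in> U"
proof
  assume "conj_elt G (inv x) g \<in> U"
  then have "conj_elt G x (conj_elt G (inv x) g) \<in> conj_set G x U"
    unfolding conj_set_conj_elt by (rule imageI)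
  then show "g \<in> conj_set G x U" using assms by simp
qed (use assms in \<open>auto simp: conj_set_conj_elt subset_iff\<close>)

lemma conj_set_subset: "x \<in> carrier G \<Longrightarrow> U \<subseteq> carrier G \<Longrightarrow> conj_set G x U \<subseteq> carrier G"
  by (auto simp: conj_set_conj_elt)

lemma card_conj_set: "x \<in> carrier G \<Longrightarrow> U \<subseteq> carrier G \<Longrightarrow> card (conj_set G x U) = card U"
  unfolding conj_set_conj_elt by (rule card_image, rule inj_on_subset[OF inj_on_conj_elt])

lemma conj_set_conj_set:
  assumes "x \<in> carrier G" "y \<in> carrier G" "U \<subseteq> carrier G"
  shows "conj_set G x (conj_set G y U) = conj_set G (x \<otimes> y) U"
  unfolding conj_set_conj_elt image_image using assms by (intro image_cong) (auto simp: conj_elt_conj_elt)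

lemma conj_set_one: "U \<subseteq> carrier G \<Longrightarrow> conj_set G \<one> U = U"
  unfolding conj_set_conj_elt by (auto simp: subset_iff image_iff)

lemma conj_set_Int:
  assumes "x \<in> carrier G" "U \<subseteq> carrier G" "V \<subseteq> carrier G"
  shows "conj_set G x (U \<inter> V) = conj_set G x U \<inter> conj_set G x V"
  unfolding conj_set_conj_elt using inj_on_conj_elt[OF assms(1)] assms by (simp add: inj_on_image_Int)

lemma subgroup_conj_set:
  assumes "x \<in> carrier G" "subgroup U G"
  shows "subgroup (conj_set G x U) G"
proof (rule subgroupI)
  have U: "U \<subseteq> carrier G" using assms subgroup.subset by blast
  show "conj_set G x U \<subseteq> carrier G" using conj_set_subset assms U by blast
  show "conj_set G x U \<noteq> {}" using subgroup.one_closed[OF assms(2)] by (auto simp: conj_set_conj_elt)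
  fix g assume g: "g \<in> conj_set G x U"
  then obtain u where u: "u \<in> U" "g = conj_elt G x u" by (auto simp: conj_set_conj_elt)
  then have "inv g = conj_elt G x (inv u)" using U assms by (auto simp: conj_elt_inv)
  then show "inv g \<in> conj_set G x U"
    using u subgroup.m_inv_closed[OF assms(2)] by (auto simp: conj_set_conj_elt)
  fix h assume h: "h \<in> conj_set G x U"
  then obtain v where v: "v \<in> U" "h = conj_elt G x v" by (auto simp: conj_set_conj_elt)
  have "g \<otimes> h = conj_elt G x (u \<otimes> v)" using U assms u v by (simp add: conj_elt_mult subset_iff)
  then show "g \<otimes> h \<in> conj_set G x U"
    using u v subgroup.m_closed[OF assms(2)] by (auto simp: conj_set_conj_elt)
qed

lemma conj_set_self:
  assumes "subgroup U G" "x \<in> U"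
  shows "conj_set G x U = U"
proof -
  have sub: "y \<in> U \<Longrightarrow> conj_set G y U \<subseteq> U" for y
    using subgroup.m_closed[OF assms(1)] subgroup.m_inv_closed[OF assms(1)]
    by (auto simp: conj_set_conj_elt conj_elt_def)
  have U: "U \<subseteq> carrier G" "inv x \<in> U"
    using assms by (simp_all add: subgroup.subset subgroup.m_inv_closed)
  have "U = conj_set G x (conj_set G (inv x) U)"
    using U assms(2) by (simp add: conj_set_conj_set conj_set_one subsetD)
  also have "\<dots> \<subseteq> conj_set G x U" using sub[OF U(2)] by (auto simp: conj_set_conj_elt)
  finally show ?thesis using sub[OF assms(2)] by blast
qed

lemma normal_conj_elt_iff:
  assumes "K \<lhd> G" "x \<in> carrier G" "g \<in> carrier G"
  shows "conj_elt G x g \<in> K \<longleftrightarrow> g \<in> K"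
proof
  assume "conj_elt G x g \<in> K"
  then have "conj_elt G (inv x) (conj_elt G x g) \<in> K"
    using normal.inv_op_closed1[OF assms(1)] assms(2) by (simp add: conj_elt_def)
  then show "g \<in> K" using assms by simp
qed (use normal.inv_op_closed2[OF assms(1)] assms in \<open>simp add: conj_elt_def\<close>)

lemma conj_set_normal:
  assumes "K \<lhd> G" "x \<in> carrier G"
  shows "conj_set G x K = K"
proof -
  have K: "K \<subseteq> carrier G" using assms(1) by (simp add: normal_imp_subgroup subgroup.subset)
  show ?thesis
    using mem_conj_set_iff[OF assms(2) K] conj_set_subset[OF assms(2) K] K assms
    by (auto simp: normal_conj_elt_iff)
qed

section \<open>Double cosets: cardinalities and sums over representatives\<close>

lemma mem_double_coset_iff:
  "d \<in> P <#> (t <# Q) \<longleftrightarrow> (\<exists>x\<in>P. \<exists>y\<in>Q. d = x \<otimes> (t \<otimes> y))"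
  by (auto simp: set_mult_def l_coset_def)

lemma double_coset_self:
  assumes "subgroup P G" "subgroup Q G" "t \<in> carrier G"
  shows "t \<in> P <#> (t <# Q)"
  unfolding mem_double_coset_iff
  using assms by (intro bexI[of _ \<one>]) (simp_all add: subgroup.one_closed)

lemma double_coset_eq:
  assumes P: "subgroup P G" and Q: "subgroup Q G" and t: "t \<in> carrier G"
    and s: "s \<in> P <#> (t <# Q)"
  shows "P <#> (s <# Q) = P <#> (t <# Q)"
proof -
  obtain x y where xy: "x \<in> P" "y \<in> Q" and s_eq: "s = x \<otimes> (t \<otimes> y)"
    using s by (auto simp: mem_double_coset_iff)
  note sub = subgroup.mem_carrier[OF P] subgroup.mem_carrier[OF Q]
  have 1: "u \<otimes> (s \<otimes> v) = (u \<otimes> x) \<otimes> (t \<otimes> (y \<otimes> v))" if "u \<in> P" "v \<in> Q" for u v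
    using that xy t sub by (simp add: s_eq m_assoc)
  have 2: "u \<otimes> (t \<otimes> v) = (u \<otimes> inv x) \<otimes> (s \<otimes> (inv y \<otimes> v))" if "u \<in> P" "v \<in> Q" for u v
    using that xy t sub by (simp add: s_eq m_assoc)
  show ?thesis
  proof (rule equalityI; rule subsetI)
    fix d assume "d \<in> P <#> (s <# Q)"
    then obtain u v where uv: "u \<in> P" "v \<in> Q" "d = u \<otimes> (s \<otimes> v)"
      by (auto simp: mem_double_coset_iff)
    show "d \<in> P <#> (t <# Q)"
      unfolding mem_double_coset_iff uv(3) 1[OF uv(1,2)]
      using uv xy subgroup.m_closed[OF P] subgroup.m_closed[OF Q] by blast
  next
    fix d assume "d \<in> P <#> (t <# Q)"
    then obtain u v where uv: "u \<in> P" "v \<in> Q" "d = u \<otimes> (t \<otimes> v)"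
      by (auto simp: mem_double_coset_iff)
    show "d \<in> P <#> (s <# Q)"
      unfolding mem_double_coset_iff uv(3) 2[OF uv(1,2)]
      using uv xy subgroup.m_closed[OF P] subgroup.m_closed[OF Q]
        subgroup.m_inv_closed[OF P] subgroup.m_inv_closed[OF Q] by blast
  qed
qed

text \<open>The map (x, y) \<mapsto> x t y from P \<times> Q onto the double coset has fibres that
  are all in bijection with P \<inter> tQt^-1.\<close>

lemma card_double_coset:
  assumes P: "subgroup P G" and Q: "subgroup Q G" and t: "t \<in> carrier G"
    and fin: "finite (carrier G)"
  shows "card (P <#> (t <# Q)) * card (P \<inter> conj_set G t Q) = card P * card Q"
proof -
  let ?f = "\<lambda>(x, y). x \<otimes> (t \<otimes> y)"
  let ?D = "P <#> (t <# Q)"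
  note sub = subgroup.mem_carrier[OF P] subgroup.mem_carrier[OF Q]
  have finPQ: "finite P" "finite Q"
    using finite_subset[OF subgroup.subset fin] P Q by simp_all
  have D: "?D = ?f ` (P \<times> Q)" by (force simp: mem_double_coset_iff image_iff)
  have fiber: "card {p \<in> P \<times> Q. ?f p = d} = card (P \<inter> conj_set G t Q)" if d: "d \<in> ?D" for d
  proof -
    obtain a b where ab: "a \<in> P" "b \<in> Q" and d_eq: "d = a \<otimes> (t \<otimes> b)"
      using d by (auto simp: mem_double_coset_iff)
    \<comment> \<open>The fibre through (a, b): right multiplication of a by z is undone by the
      factor t^-1 z^-1 t in front of b.\<close>
    let ?h = "\<lambda>z. (a \<otimes> z, conj_elt G (inv t) (inv z) \<otimes> b)"
    have "bij_betw ?h (P \<inter> conj_set G t Q) {p \<in> P \<times> Q. ?f p = d}"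
    proof (rule bij_betw_byWitness[where f' = "\<lambda>p. inv a \<otimes> fst p"])
      show "\<forall>z\<in>P \<inter> conj_set G t Q. inv a \<otimes> fst (?h z) = z"
        using ab sub by simp
      have eq: "x \<otimes> (t \<otimes> y) = a \<otimes> (t \<otimes> b)" if "(x, y) \<in> {p \<in> P \<times> Q. ?f p = d}" for x y
        using that d_eq by simp
      show "\<forall>p\<in>{p \<in> P \<times> Q. ?f p = d}. ?h (inv a \<otimes> fst p) = p"
      proof
        fix p assume p: "p \<in> {p \<in> P \<times> Q. ?f p = d}"
        obtain x y where p_eq: "p = (x, y)" by (cases p)
        then have xy: "x \<in> P" "y \<in> Q" using p by auto
        have "conj_elt G (inv t) (inv (inv a \<otimes> x)) \<otimes> b = inv t \<otimes> (inv x \<otimes> (a \<otimes> (t \<otimes> b)))"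
          using ab xy t sub by (simp add: conj_elt_def inv_mult_group m_assoc)
        also have "\<dots> = inv t \<otimes> (inv x \<otimes> (x \<otimes> (t \<otimes> y)))" using eq[of x y] p p_eq by simp
        also have "\<dots> = y" using xy t sub by simp
        finally show "?h (inv a \<otimes> fst p) = p"
          using ab xy sub by (simp add: p_eq)
      qed
      show "?h ` (P \<inter> conj_set G t Q) \<subseteq> {p \<in> P \<times> Q. ?f p = d}"
      proof (rule image_subsetI)
        fix z assume "z \<in> P \<inter> conj_set G t Q"
        then have z: "z \<in> P" "z \<in> conj_set G t Q" by auto
        then have 1: "a \<otimes> z \<in> P" using ab subgroup.m_closed[OF P] by simp
        have zQ: "conj_elt G (inv t) z \<in> Q"
          using z t sub subgroup.subset[OF Q] mem_conj_set_iff[of t Q z] by simp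
        then have 2: "conj_elt G (inv t) (inv z) \<otimes> b \<in> Q"
          using ab z t sub subgroup.m_closed[OF Q] subgroup.m_inv_closed[OF Q] by (simp add: conj_elt_inv)
        have "a \<otimes> z \<otimes> (t \<otimes> (conj_elt G (inv t) (inv z) \<otimes> b)) = d"
          using ab z t sub by (simp add: d_eq conj_elt_def m_assoc)
        with 1 2 show "?h z \<in> {p \<in> P \<times> Q. ?f p = d}" by simp
      qed
      show "(\<lambda>p. inv a \<otimes> fst p) ` {p \<in> P \<times> Q. ?f p = d} \<subseteq> P \<inter> conj_set G t Q"
      proof (rule image_subsetI)
        fix p assume p: "p \<in> {p \<in> P \<times> Q. ?f p = d}"
        obtain x y where p_eq: "p = (x, y)" by (cases p)
        then have xy: "x \<in> P" "y \<in> Q" using p by auto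
        have 1: "inv a \<otimes> x \<in> P"
          using ab xy subgroup.m_closed[OF P] subgroup.m_inv_closed[OF P] by simp
        have "inv a \<otimes> (a \<otimes> (t \<otimes> b) \<otimes> inv (t \<otimes> y)) = inv a \<otimes> (x \<otimes> (t \<otimes> y) \<otimes> inv (t \<otimes> y))"
          using eq[of x y] p p_eq by simp
        also have "\<dots> = inv a \<otimes> x"
          using xy ab t sub by (simp add: m_assoc inv_mult_group)
        finally have "inv a \<otimes> x = conj_elt G t (b \<otimes> inv y)"
          using ab xy t sub by (simp add: conj_elt_def m_assoc inv_mult_group)
        moreover have "b \<otimes> inv y \<in> Q"
          using ab xy subgroup.m_closed[OF Q] subgroup.m_inv_closed[OF Q] by simp
        ultimately have "inv a \<otimes> x \<in> conj_set G t Q" by (simp add: conj_set_conj_elt)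
        with 1 show "inv a \<otimes> fst p \<in> P \<inter> conj_set G t Q" by (simp add: p_eq)
      qed
    qed
    then show ?thesis by (simp add: bij_betw_same_card)
  qed
  have "card P * card Q = (\<Sum>p\<in>P \<times> Q. 1)" using finPQ by simp
  also have "\<dots> = (\<Sum>d\<in>?D. \<Sum>p\<in>{p \<in> P \<times> Q. ?f p = d}. 1)"
    using finPQ by (intro sum.group[symmetric]) (auto simp: D)
  also have "\<dots> = card ?D * card (P \<inter> conj_set G t Q)"
    using fiber by simp
  finally show ?thesis by simp
qed

text \<open>Each element t of a double coset D contributes the same term, and |D| |P \<inter>
  tQt^-1| = |P| |Q|. The factor |P| |Q| stands on the left because it need not be cancellable in the
  coefficient ring.\<close>

lemma sum_double_coset_reps:
  fixes f :: "'a \<Rightarrow> ('c \<Rightarrow>\<^sub>0 'k::{comm_ring,comm_monoid_mult})"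
  assumes P: "subgroup P G" and Q: "subgroup Q G" and fin: "finite (carrier G)"
    and f: "\<And>x t y. \<lbrakk>x \<in> P; y \<in> Q; t \<in> carrier G\<rbrakk> \<Longrightarrow> f (x \<otimes> (t \<otimes> y)) = f t"
  shows "scale (int_embed (int (card P * card Q))) (\<Sum>t\<in>double_coset_reps G P Q. f t) =
    (\<Sum>t\<in>carrier G. scale (int_embed (int (card (P \<inter> conj_set G t Q)))) (f t))"
proof -
  let ?dc = "\<lambda>t. P <#> (t <# Q)"
  let ?n = "int_embed (int (card P * card Q)) :: 'k"
  let ?r = "\<lambda>D. SOME t. t \<in> D"
  have dcs: "double_cosets G P Q = ?dc ` carrier G" by (auto simp: double_cosets_def)
  have sub: "?dc t \<subseteq> carrier G" if "t \<in> carrier G" for t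
    using that subgroup.mem_carrier[OF P] subgroup.mem_carrier[OF Q]
    by (auto simp: mem_double_coset_iff)
  have rep: "?r (?dc t) \<in> ?dc t" if "t \<in> carrier G" for t
    using double_coset_self[OF P Q that] by (rule someI)
  have inj: "inj_on ?r (double_cosets G P Q)"
  proof (rule inj_on_inverseI[of _ ?dc])
    fix D assume "D \<in> double_cosets G P Q"
    then obtain t where t: "t \<in> carrier G" "D = ?dc t" by (auto simp: dcs)
    then show "?dc (?r D) = D" using double_coset_eq[OF P Q t(1) rep[OF t(1)]] by simp
  qed
  have fibre: "{t \<in> carrier G. ?dc t = ?dc s} = ?dc s" if "s \<in> carrier G" for s
    using sub[OF that] double_coset_eq[OF P Q that] double_coset_self[OF P Q] by auto
  have "(\<Sum>t\<in>carrier G. scale (int_embed (int (card (P \<inter> conj_set G t Q)))) (f t)) =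
    (\<Sum>D\<in>double_cosets G P Q. \<Sum>t\<in>{t \<in> carrier G. ?dc t = D}.
       scale (int_embed (int (card (P \<inter> conj_set G t Q)))) (f t))"
    using fin by (intro sum.group[symmetric]) (auto simp: dcs)
  also have "\<dots> = (\<Sum>D\<in>double_cosets G P Q. scale ?n (f (?r D)))"
  proof (intro sum.cong refl)
    fix D assume "D \<in> double_cosets G P Q"
    then obtain s0 where s0: "s0 \<in> carrier G" "D = ?dc s0" by (auto simp: dcs)
    define s where "s = ?r D"
    have s: "s \<in> carrier G" using rep[OF s0(1)] sub[OF s0(1)] s0 by (auto simp: s_def)
    have D: "D = ?dc s" using double_coset_eq[OF P Q s0(1) rep[OF s0(1)]] s0 by (simp add: s_def)
    have finD: "finite D" using sub[OF s] fin D finite_subset by blast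
    have "(\<Sum>t\<in>{t \<in> carrier G. ?dc t = D}.
        scale (int_embed (int (card (P \<inter> conj_set G t Q)))) (f t)) =
      (\<Sum>t\<in>D. scale (int_embed (int (card (P \<inter> conj_set G s Q)))) (f s))"
    proof (intro sum.cong)
      show "{t \<in> carrier G. ?dc t = D} = D" using fibre[OF s] D by simp
      fix t assume t: "t \<in> D"
      then have tC: "t \<in> carrier G" using sub[OF s] D by blast
      have "?dc t = D" using double_coset_eq[OF P Q s] t D by simp
      \<comment> \<open>The cancellation of |D| takes place among natural numbers, before passing to
        coefficients.\<close>
      then have "card D * card (P \<inter> conj_set G t Q) = card D * card (P \<inter> conj_set G s Q)"
        using card_double_coset[OF P Q tC fin] card_double_coset[OF P Q s fin] D by simp
      moreover have "card D \<noteq> 0" using t finD by auto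
      ultimately have "card (P \<inter> conj_set G t Q) = card (P \<inter> conj_set G s Q)" by simp
      moreover have "f t = f s" using t D f s by (auto simp: mem_double_coset_iff)
      ultimately show "scale (int_embed (int (card (P \<inter> conj_set G t Q)))) (f t) =
        scale (int_embed (int (card (P \<inter> conj_set G s Q)))) (f s)" by simp
    qed
    also have "\<dots> = scale (int_embed (int (card D * card (P \<inter> conj_set G s Q)))) (f s)"
      by (simp add: sum_const_scale scale_scale int_embed_mult)
    also have "\<dots> = scale ?n (f (?r D))"
      using card_double_coset[OF P Q s fin] by (simp flip: D s_def)
    finally show "(\<Sum>t\<in>{t \<in> carrier G. ?dc t = D}.
        scale (int_embed (int (card (P \<inter> conj_set G t Q)))) (f t)) = scale ?n (f (?r D))" .
  qed
  also have "\<dots> = scale ?n (\<Sum>t\<in>double_coset_reps G P Q. f t)"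
    unfolding double_coset_reps_def sum.reindex[OF inj] by (simp add: scale_sum)
  finally show ?thesis by simp
qed

section \<open>The Frattini subgroup and the support of the Moebius function\<close>

lemma finite_subgroups: "finite (carrier G) \<Longrightarrow> finite {X. subgroup X G}"
  by (rule finite_subset[of _ "Pow (carrier G)"]) (auto dest: subgroup.subset)

lemma frattini_subgroup: "subgroup (frattini G) G"
proof -
  \<comment> \<open>Inserting \<open>carrier G\<close> keeps the family nonempty even if there is no
    maximal subgroup, as in the trivial group.\<close>
  have "frattini G = \<Inter> (insert (carrier G) {M. maximal_subgroup G M})"
    by (auto simp: frattini_def)
  moreover have "subgroup \<dots> G"
    by (rule subgroups_Inter) (auto simp: maximal_subgroup_def subgroup_self)
  ultimately show ?thesis by simp
qed

lemma proper_subgroup_le_maximal: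
  assumes "finite (carrier G)" "subgroup X G" "X \<noteq> carrier G"
  obtains M where "maximal_subgroup G M" "X \<subseteq> M"
proof -
  let ?S = "{N. subgroup N G \<and> N \<noteq> carrier G}"
  have "finite ?S" using finite_subgroups[OF assms(1)] by simp
  moreover have "X \<in> ?S" using assms by simp
  ultimately have "\<exists>M\<in>?S. X \<subseteq> M \<and> (\<forall>N\<in>?S. M \<subseteq> N \<longrightarrow> M = N)"
    by (rule finite_has_maximal2)
  then obtain M where M: "M \<in> ?S" "X \<subseteq> M" "\<forall>N\<in>?S. M \<subseteq> N \<longrightarrow> M = N" by (elim bexE conjE)
  then have "maximal_subgroup G M" unfolding maximal_subgroup_def by auto
  then show thesis using M(2) by (rule that)
qed

text \<open>Descending induction on X. The join J of X and the Frattini subgroup is proper, because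
  a maximal subgroup above X contains both. So the Moebius sums over [X, G] and over [J, G] both
  vanish, and by induction they differ only in the term of X.\<close>

lemma mu_sub_eq_0:
  assumes fin: "finite (carrier G)" and X: "subgroup X G" and nle: "\<not> frattini G \<subseteq> X"
  shows "mu_sub G X (carrier G) = 0"
  using X nle
proof (induction "card (carrier G) - card X" arbitrary: X rule: less_induct)
  case less
  let ?P = "{X. subgroup X G}"
  let ?J = "\<Inter> {Z. subgroup Z G \<and> X \<union> frattini G \<subseteq> Z}"
  have finP: "finite ?P" by (rule finite_subgroups[OF fin])
  have sub: "\<And>Z. subgroup Z G \<Longrightarrow> Z \<subseteq> carrier G" by (rule subgroup.subset)
  have fr: "frattini G \<subseteq> carrier G" by (simp add: frattini_def)
  have XC: "X \<noteq> carrier G" using less.prems fr by blast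
  obtain M where M: "maximal_subgroup G M" "X \<subseteq> M"
    using proper_subgroup_le_maximal[OF fin less.prems(1) XC] .
  have "frattini G \<subseteq> M" using M by (auto simp: frattini_def)
  with M have JM: "?J \<subseteq> M" by (auto simp: maximal_subgroup_def)
  have "M \<subset> carrier G" using M sub by (auto simp: maximal_subgroup_def)
  with JM have JC: "?J \<noteq> carrier G" by blast
  have J: "subgroup ?J G"
    using less.prems fr sub[of X] subgroup_self by (intro subgroups_Inter) auto
  let ?I = "{Z \<in> ?P. X \<subseteq> Z \<and> Z \<subseteq> carrier G}"
  have XI: "X \<in> ?I" using less.prems sub by auto
  have "0 = (\<Sum>Z\<in>?I. mu_sub G Z (carrier G))"
    using moebius_sum_right[OF finP _ _ fin, of X] less.prems XC sub subgroup_self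
    by (simp add: mu_sub_def)
  also have "\<dots> = mu_sub G X (carrier G) + (\<Sum>Z\<in>?I - {X}. mu_sub G Z (carrier G))"
    using XI finP by (subst sum.remove[of ?I X]) auto
  \<comment> \<open>Subgroups strictly above X that do not contain the Frattini subgroup drop out by
    induction; the remaining ones are those above J.\<close>
  also have "(\<Sum>Z\<in>?I - {X}. mu_sub G Z (carrier G)) =
      (\<Sum>Z\<in>{Z \<in> ?P. ?J \<subseteq> Z \<and> Z \<subseteq> carrier G}. mu_sub G Z (carrier G))"
  proof (rule sum.mono_neutral_right)
    show "finite (?I - {X})" using finP by simp
    show "{Z \<in> ?P. ?J \<subseteq> Z \<and> Z \<subseteq> carrier G} \<subseteq> ?I - {X}" using less.prems by auto
    show "\<forall>Z\<in>?I - {X} - {Z \<in> ?P. ?J \<subseteq> Z \<and> Z \<subseteq> carrier G}. mu_sub G Z (carrier G) = 0"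
    proof
      fix Z assume Z: "Z \<in> ?I - {X} - {Z \<in> ?P. ?J \<subseteq> Z \<and> Z \<subseteq> carrier G}"
      then have "\<not> frattini G \<subseteq> Z" by auto
      moreover have "card X < card Z" "card Z \<le> card (carrier G)"
        using Z fin by (auto intro!: psubset_card_mono card_mono intro: finite_subset)
      ultimately show "mu_sub G Z (carrier G) = 0" using less.hyps[of Z] Z by simp
    qed
  qed
  also have "\<dots> = 0"
    using moebius_sum_right[OF finP _ _ fin, of ?J] J JC sub[OF J] subgroup_self
    by (simp add: mu_sub_def)
  finally show ?case by simp
qed

end

subsection \<open>Twisted diagonals\<close>

text \<open>For \<open>a = b = 1\<close> this is \<open>{(g, h) \<in> X \<times> X. gK = hK}\<close> with the character
  \<open>(g, h) \<mapsto> \<kappa> (h\<inverse> g)\<close>; general \<open>a\<close>, \<open>b\<close> give its conjugates under \<open>(a, b)\<close>. All of them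
  have to be multiplied, because \<open>fib_comp\<close> picks an arbitrary representative of a class.\<close>

definition twisted_diag :: "('a, 'm) monoid_scheme \<Rightarrow> 'a \<Rightarrow> 'a \<Rightarrow> 'a set \<Rightarrow> 'a set \<Rightarrow> ('a \<times> 'a) set" where
  "twisted_diag G a b X K = {(g, h). g \<in> carrier G \<and> h \<in> carrier G \<and>
     conj_elt G (inv\<^bsub>G\<^esub> a) g \<in> X \<and> conj_elt G (inv\<^bsub>G\<^esub> b) h \<in> X \<and>
     inv\<^bsub>G\<^esub> (conj_elt G (inv\<^bsub>G\<^esub> b) h) \<otimes>\<^bsub>G\<^esub> conj_elt G (inv\<^bsub>G\<^esub> a) g \<in> K}"

definition twisted_char :: "('a, 'm) monoid_scheme \<Rightarrow> 'a \<Rightarrow> 'a \<Rightarrow> 'a set \<Rightarrow> 'a set \<Rightarrow> ('a \<Rightarrow> complex)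
    \<Rightarrow> 'a \<times> 'a \<Rightarrow> complex" where
  "twisted_char G a b X K \<kappa> = (\<lambda>(g, h) \<in> twisted_diag G a b X K.
     \<kappa> (inv\<^bsub>G\<^esub> (conj_elt G (inv\<^bsub>G\<^esub> b) h) \<otimes>\<^bsub>G\<^esub> conj_elt G (inv\<^bsub>G\<^esub> a) g))"

text \<open>A whole conjugacy class in closed form, so that a representative chosen by
  \<open>SOME\<close> can be unpacked into parameters a and b.\<close>

definition twisted_class :: "('a, 'm) monoid_scheme \<Rightarrow> 'a set \<Rightarrow> 'a set \<Rightarrow> ('a \<Rightarrow> complex)
    \<Rightarrow> ('a, 'a) fib_class" where
  "twisted_class G X K \<kappa> =
     {(twisted_diag G a b X K, twisted_char G a b X K \<kappa>) | a b. a \<in> carrier G \<and> b \<in> carrier G}"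

text \<open>The condition of \<open>frattini_pairs\<close> apart from the inclusion in the Frattini
  subgroup. The calculus below works with inclusions in X and Y instead.\<close>

definition invariant_pair :: "('a, 'm) monoid_scheme \<Rightarrow> 'a set \<Rightarrow> ('a \<Rightarrow> complex) \<Rightarrow> bool" where
  "invariant_pair G K \<kappa> \<longleftrightarrow> K \<lhd> G \<and> \<kappa> \<in> dual G K \<and> (\<forall>g\<in>carrier G. conj_char G g K \<kappa> = \<kappa>)"

lemma restrict_cong_set: "A = B \<Longrightarrow> (\<And>x. x \<in> B \<Longrightarrow> f x = g x) \<Longrightarrow> restrict f A = restrict g B"
  by (auto simp: restrict_def)

context group begin

lemma invariant_pairD:
  assumes "invariant_pair G K \<kappa>"
  shows "K \<lhd> G" "subgroup K G" "K \<subseteq> carrier G" "\<one> \<in> K" "\<kappa> \<in> extensional K"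
    "\<And>k l. k \<in> K \<Longrightarrow> l \<in> K \<Longrightarrow> \<kappa> (k \<otimes> l) = \<kappa> k * \<kappa> l"
    "\<And>k. k \<in> K \<Longrightarrow> \<kappa> k \<noteq> 0"
    "\<kappa> \<one> = 1"
    "\<And>k. k \<in> K \<Longrightarrow> \<kappa> (inv k) = inverse (\<kappa> k)"
    "\<And>g k. g \<in> carrier G \<Longrightarrow> k \<in> K \<Longrightarrow> \<kappa> (conj_elt G g k) = \<kappa> k"
proof -
  show N: "K \<lhd> G" using assms by (simp add: invariant_pair_def)
  show S: "subgroup K G" using N by (rule normal_imp_subgroup)
  show C: "K \<subseteq> carrier G" using S by (rule subgroup.subset)
  show 1: "\<one> \<in> K" using S by (rule subgroup.one_closed)
  show "\<kappa> \<in> extensional K" using assms by (simp add: invariant_pair_def dual_def)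
  have hom: "\<kappa> \<in> hom (G\<lparr>carrier := K\<rparr>) Cx" using assms by (simp add: invariant_pair_def dual_def)
  show mult: "\<And>k l. k \<in> K \<Longrightarrow> l \<in> K \<Longrightarrow> \<kappa> (k \<otimes> l) = \<kappa> k * \<kappa> l"
    using hom by (simp add: hom_def Cx_def)
  show nz: "\<And>k. k \<in> K \<Longrightarrow> \<kappa> k \<noteq> 0"
    using hom by (auto simp: hom_def Cx_def Pi_iff)
  show one: "\<kappa> \<one> = 1" using mult[OF 1 1] nz[OF 1] by simp
  show "\<kappa> (inv k) = inverse (\<kappa> k)" if k: "k \<in> K" for k
  proof -
    have "inv k \<in> K" using S k by (rule subgroup.m_inv_closed)
    then have "\<kappa> k * \<kappa> (inv k) = 1" using mult[OF k, of "inv k"] one k C by (simp add: subsetD)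
    then show ?thesis using nz[OF k] by (simp add: field_simps)
  qed
  show "\<kappa> (conj_elt G g k) = \<kappa> k" if g: "g \<in> carrier G" and k: "k \<in> K" for g k
  proof -
    have "\<kappa> (conj_elt G g k) = conj_char G g K \<kappa> (conj_elt G g k)"
      using assms g by (simp add: invariant_pair_def)
    also have "\<dots> = \<kappa> (inv g \<otimes> conj_elt G g k \<otimes> g)"
      using k by (simp add: conj_char_def conj_set_conj_elt)
    also have "inv g \<otimes> conj_elt G g k \<otimes> g = k"
      using g k C by (simp add: conj_elt_def m_assoc subsetD)
    finally show ?thesis .
  qed
qed

section \<open>Conjugates and classes of twisted diagonals\<close>

lemma conj_set_DirProd:
  assumes "x \<in> carrier G" "y \<in> carrier G"
  shows "conj_set (G \<times>\<times> G) (x, y) U = (\<lambda>(g, h). (conj_elt G x g, conj_elt G y h)) ` U"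
  unfolding conj_set_def using assms
  by (intro image_cong refl) (clarsimp simp: inv_DirProd is_group conj_elt_def)

lemma conj_set_twisted_diag:
  assumes "x \<in> carrier G" "y \<in> carrier G" "a \<in> carrier G" "b \<in> carrier G"
  shows "conj_set (G \<times>\<times> G) (x, y) (twisted_diag G a b X K) = twisted_diag G (x \<otimes> a) (y \<otimes> b) X K"
proof (rule equalityI; rule subsetI)
  fix p assume "p \<in> conj_set (G \<times>\<times> G) (x, y) (twisted_diag G a b X K)"
  then obtain g h where "(g, h) \<in> twisted_diag G a b X K" "p = (conj_elt G x g, conj_elt G y h)"
    by (auto simp: conj_set_DirProd assms)
  then show "p \<in> twisted_diag G (x \<otimes> a) (y \<otimes> b) X K"
    using assms by (simp add: twisted_diag_def conj_elt_conj_elt inv_mult_group m_assoc)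
next
  fix p assume p: "p \<in> twisted_diag G (x \<otimes> a) (y \<otimes> b) X K"
  obtain g h where gh: "p = (g, h)" by (cases p)
  have "(conj_elt G (inv x) g, conj_elt G (inv y) h) \<in> twisted_diag G a b X K"
    using p assms by (simp add: gh twisted_diag_def conj_elt_conj_elt inv_mult_group)
  moreover have "p = (conj_elt G x (conj_elt G (inv x) g), conj_elt G y (conj_elt G (inv y) h))"
    using p assms by (simp add: gh twisted_diag_def)
  ultimately show "p \<in> conj_set (G \<times>\<times> G) (x, y) (twisted_diag G a b X K)"
    unfolding conj_set_DirProd[OF assms(1,2)] by (intro image_eqI) auto
qed

lemma conj_char_twisted_char:
  assumes "x \<in> carrier G" "y \<in> carrier G" "a \<in> carrier G" "b \<in> carrier G"
  shows "conj_char (G \<times>\<times> G) (x, y) (twisted_diag G a b X K) (twisted_char G a b X K \<kappa>) =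
    twisted_char G (x \<otimes> a) (y \<otimes> b) X K \<kappa>"
  unfolding conj_char_def twisted_char_def[of G "x \<otimes> a"]
proof (rule restrict_cong_set[OF conj_set_twisted_diag[OF assms]])
  fix p assume p: "p \<in> twisted_diag G (x \<otimes> a) (y \<otimes> b) X K"
  obtain g h where gh: "p = (g, h)" by (cases p)
  have "inv\<^bsub>G \<times>\<times> G\<^esub> (x, y) \<otimes>\<^bsub>G \<times>\<times> G\<^esub> p \<otimes>\<^bsub>G \<times>\<times> G\<^esub> (x, y) = (conj_elt G (inv x) g, conj_elt G (inv y) h)"
    using assms by (simp add: gh conj_elt_def inv_DirProd is_group)
  moreover have "(conj_elt G (inv x) g, conj_elt G (inv y) h) \<in> twisted_diag G a b X K"
    using p assms by (simp add: gh twisted_diag_def conj_elt_conj_elt inv_mult_group)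
  ultimately show "twisted_char G a b X K \<kappa>
      (inv\<^bsub>G \<times>\<times> G\<^esub> (x, y) \<otimes>\<^bsub>G \<times>\<times> G\<^esub> p \<otimes>\<^bsub>G \<times>\<times> G\<^esub> (x, y)) =
    (case p of (g, h) \<Rightarrow> \<kappa> (inv (conj_elt G (inv (y \<otimes> b)) h) \<otimes> conj_elt G (inv (x \<otimes> a)) g))"
    using p assms by (simp add: gh twisted_char_def twisted_diag_def conj_elt_conj_elt inv_mult_group)
qed

text \<open>Conjugation acts on the parameters (a, b) by left translation, and this action is
  transitive.\<close>

lemma fib_class_twisted:
  assumes "a \<in> carrier G" "b \<in> carrier G"
  shows "fib_class G G (twisted_diag G a b X K) (twisted_char G a b X K \<kappa>) = twisted_class G X K \<kappa>"
proof (rule equalityI; rule subsetI)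
  fix p assume "p \<in> fib_class G G (twisted_diag G a b X K) (twisted_char G a b X K \<kappa>)"
  then obtain x y where "x \<in> carrier G" "y \<in> carrier G"
      "p = (twisted_diag G (x \<otimes> a) (y \<otimes> b) X K, twisted_char G (x \<otimes> a) (y \<otimes> b) X K \<kappa>)"
    by (auto simp: fib_class_def conj_set_twisted_diag conj_char_twisted_char assms)
  then show "p \<in> twisted_class G X K \<kappa>" using assms unfolding twisted_class_def by blast
next
  fix p assume "p \<in> twisted_class G X K \<kappa>"
  then obtain x y where xy: "x \<in> carrier G" "y \<in> carrier G"
      "p = (twisted_diag G x y X K, twisted_char G x y X K \<kappa>)"
    by (auto simp: twisted_class_def)
  let ?z = "(x \<otimes> inv a, y \<otimes> inv b)"
  have "p = (conj_set (G \<times>\<times> G) ?z (twisted_diag G a b X K),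
      conj_char (G \<times>\<times> G) ?z (twisted_diag G a b X K) (twisted_char G a b X K \<kappa>))"
    using xy assms by (simp add: conj_set_twisted_diag conj_char_twisted_char m_assoc)
  moreover have "?z \<in> carrier (G \<times>\<times> G)" using xy assms by simp
  ultimately show "p \<in> fib_class G G (twisted_diag G a b X K) (twisted_char G a b X K \<kappa>)"
    unfolding fib_class_def by blast
qed

text \<open>Replacing X by xXx^-1 conjugates the argument of kappa by x, which normality of K and
  invariance of kappa absorb. Thus a common right factor of both parameters can be traded for a
  conjugation of X.\<close>

lemma twisted_conj_set:
  assumes K: "invariant_pair G K \<kappa>" and X: "X \<subseteq> carrier G"
    and "a \<in> carrier G" "b \<in> carrier G" "x \<in> carrier G"
  shows "twisted_diag G a b (conj_set G x X) K = twisted_diag G (a \<otimes> x) (b \<otimes> x) X K" (is "?A = ?B")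
    and "twisted_char G a b (conj_set G x X) K \<kappa> = twisted_char G (a \<otimes> x) (b \<otimes> x) X K \<kappa>"
proof -
  note K = invariant_pairD[OF K]
  have eq: "inv (conj_elt G (inv (b \<otimes> x)) h) \<otimes> conj_elt G (inv (a \<otimes> x)) g =
      conj_elt G (inv x) (inv (conj_elt G (inv b) h) \<otimes> conj_elt G (inv a) g)"
    if "g \<in> carrier G" "h \<in> carrier G" for g h
    using assms that by (simp add: conj_elt_mult conj_elt_inv conj_elt_conj_elt inv_mult_group)
  show sets: "?A = ?B"
  proof -
    have "p \<in> ?A \<longleftrightarrow> p \<in> ?B" for p
    proof (cases p)
      case (Pair g h)
      show ?thesis
      proof (cases "g \<in> carrier G \<and> h \<in> carrier G")
        case True
        then show ?thesis
          using assms eq[of g h]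
          by (simp add: Pair twisted_diag_def mem_conj_set_iff normal_conj_elt_iff[OF K(1)])
             (simp add: conj_elt_conj_elt inv_mult_group)
      qed (auto simp: Pair twisted_diag_def)
    qed
    then show ?thesis by blast
  qed
  show "twisted_char G a b (conj_set G x X) K \<kappa> = twisted_char G (a \<otimes> x) (b \<otimes> x) X K \<kappa>"
    unfolding twisted_char_def
  proof (rule restrict_cong_set[OF sets])
    fix p assume p: "p \<in> ?B"
    obtain g h where gh: "p = (g, h)" by (cases p)
    have "(g, h) \<in> ?A" using p sets gh by simp
    then show "(case p of (g, h) \<Rightarrow> \<kappa> (inv (conj_elt G (inv b) h) \<otimes> conj_elt G (inv a) g)) =
      (case p of (g, h) \<Rightarrow> \<kappa> (inv (conj_elt G (inv (b \<otimes> x)) h) \<otimes> conj_elt G (inv (a \<otimes> x)) g))"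
      using eq[of g h] K(10)[of "inv x"] assms by (simp add: gh twisted_diag_def)
  qed
qed

lemma twisted_class_conj_set:
  assumes "invariant_pair G K \<kappa>" "X \<subseteq> carrier G" "x \<in> carrier G"
  shows "twisted_class G (conj_set G x X) K \<kappa> = twisted_class G X K \<kappa>"
  using fib_class_twisted[of "\<one>" "\<one>" "conj_set G x X" K \<kappa>] fib_class_twisted[of x x X K \<kappa>]
    twisted_conj_set[OF assms(1,2), of \<one> \<one> x] assms by simp

section \<open>Projections, kernels and one-sided characters\<close>

lemma p1_twisted_diag:
  assumes K: "invariant_pair G K \<kappa>" and X: "X \<subseteq> carrier G"
    and ab: "a \<in> carrier G" "b \<in> carrier G"
  shows "p1 (twisted_diag G a b X K) = conj_set G a X"
proof (rule equalityI; rule subsetI)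
  fix g assume "g \<in> p1 (twisted_diag G a b X K)"
  then show "g \<in> conj_set G a X"
    using assms by (auto simp: p1_def twisted_diag_def mem_conj_set_iff)
next
  fix g assume g: "g \<in> conj_set G a X"
  then have gC: "g \<in> carrier G" using conj_set_subset[OF ab(1) X] by blast
  then have gX: "conj_elt G (inv a) g \<in> X" using g mem_conj_set_iff[OF ab(1) X] by simp
  \<comment> \<open>The partner has the same untwisted coordinate as g, so the quotient to be tested
    is the identity.\<close>
  have "(g, conj_elt G b (conj_elt G (inv a) g)) \<in> twisted_diag G a b X K"
    using gC gX ab invariant_pairD(4)[OF K] by (simp add: twisted_diag_def)
  then show "g \<in> p1 (twisted_diag G a b X K)" unfolding p1_def by (rule image_eqI[rotated]) simp
qed

lemma p2_twisted_diag:
  assumes K: "invariant_pair G K \<kappa>" and X: "X \<subseteq> carrier G"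
    and ab: "a \<in> carrier G" "b \<in> carrier G"
  shows "p2 (twisted_diag G a b X K) = conj_set G b X"
proof (rule equalityI; rule subsetI)
  fix g assume "g \<in> p2 (twisted_diag G a b X K)"
  then show "g \<in> conj_set G b X"
    using assms by (auto simp: p2_def twisted_diag_def mem_conj_set_iff)
next
  fix g assume g: "g \<in> conj_set G b X"
  then have gC: "g \<in> carrier G" using conj_set_subset[OF ab(2) X] by blast
  then have gX: "conj_elt G (inv b) g \<in> X" using g mem_conj_set_iff[OF ab(2) X] by simp
  have "(conj_elt G a (conj_elt G (inv b) g), g) \<in> twisted_diag G a b X K"
    using gC gX ab invariant_pairD(4)[OF K] by (simp add: twisted_diag_def)
  then show "g \<in> p2 (twisted_diag G a b X K)" unfolding p2_def by (rule image_eqI[rotated]) simp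
qed

lemma char1_twisted:
  assumes K: "invariant_pair G K \<kappa>" and X: "subgroup X G" and KX: "K \<subseteq> X"
    and ab: "a \<in> carrier G" "b \<in> carrier G"
  shows "k1 G (twisted_diag G a b X K) = K"
    and "char1 G (twisted_diag G a b X K) (twisted_char G a b X K \<kappa>) = \<kappa>"
proof -
  note D = invariant_pairD[OF K]
  show k1: "k1 G (twisted_diag G a b X K) = K"
    using ab D(3,4) KX subgroup.one_closed[OF X]
    by (auto simp: k1_def twisted_diag_def normal_conj_elt_iff[OF D(1)] subset_iff)
  have "char1 G (twisted_diag G a b X K) (twisted_char G a b X K \<kappa>) = restrict \<kappa> K"
    unfolding char1_def
  proof (rule restrict_cong_set[OF k1])
    fix g assume g: "g \<in> K"
    then have "(g, \<one>) \<in> twisted_diag G a b X K" using k1 by (auto simp: k1_def)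
    then show "twisted_char G a b X K \<kappa> (g, \<one>) = \<kappa> g"
      using ab g D(3) D(10)[of "inv a" g] by (auto simp: twisted_char_def)
  qed
  then show "char1 G (twisted_diag G a b X K) (twisted_char G a b X K \<kappa>) = \<kappa>"
    using D(5) by (simp add: extensional_restrict)
qed

text \<open>At (1, h) the argument of kappa is the inverse of a conjugate of h. The inverse built
  into \<open>char2\<close> undoes this, so both one-sided characters are kappa itself.\<close>

lemma char2_twisted:
  assumes K: "invariant_pair G K \<kappa>" and X: "subgroup X G" and KX: "K \<subseteq> X"
    and ab: "a \<in> carrier G" "b \<in> carrier G"
  shows "k2 G (twisted_diag G a b X K) = K"
    and "char2 G (twisted_diag G a b X K) (twisted_char G a b X K \<kappa>) = \<kappa>"
proof -
  note D = invariant_pairD[OF K]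
  have iff: "inv (conj_elt G (inv b) h) \<in> K \<longleftrightarrow> h \<in> K" if "h \<in> carrier G" for h
    using that ab D(1) subgroup.m_inv_closed[OF D(2)] normal_conj_elt_iff[OF D(1), of "inv b"]
    by (metis conj_elt_closed inv_closed inv_inv)
  show k2: "k2 G (twisted_diag G a b X K) = K"
    using ab D(3,4) KX subgroup.one_closed[OF X]
    by (auto simp: k2_def twisted_diag_def iff normal_conj_elt_iff[OF D(1)] subset_iff)
  have "char2 G (twisted_diag G a b X K) (twisted_char G a b X K \<kappa>) = restrict \<kappa> K"
    unfolding char2_def
  proof (rule restrict_cong_set[OF k2])
    fix g assume g: "g \<in> K"
    then have gC: "g \<in> carrier G" using D(3) by blast
    have "(\<one>, g) \<in> twisted_diag G a b X K" using g k2 by (auto simp: k2_def)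
    then have "twisted_char G a b X K \<kappa> (\<one>, g) = \<kappa> (inv (conj_elt G (inv b) g))"
      using ab gC by (simp add: twisted_char_def)
    also have "\<dots> = inverse (\<kappa> g)"
      using D(9)[of "conj_elt G (inv b) g"] D(10)[of "inv b" g] g gC ab
      by (simp add: normal_conj_elt_iff[OF D(1)])
    finally show "inverse (twisted_char G a b X K \<kappa> (\<one>, g)) = \<kappa> g" by simp
  qed
  then show "char2 G (twisted_diag G a b X K) (twisted_char G a b X K \<kappa>) = \<kappa>"
    using D(5) by (simp add: extensional_restrict)
qed

text \<open>Conjugation by t fixes L and its character, so t disappears from the condition.\<close>

lemma compatible_twisted:
  assumes K: "invariant_pair G K \<kappa>" and X: "subgroup X G" "K \<subseteq> X"
    and L: "invariant_pair G L \<Lambda>" and Y: "subgroup Y G" "L \<subseteq> Y"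
    and abcd: "a \<in> carrier G" "b \<in> carrier G" "c \<in> carrier G" "d \<in> carrier G"
    and t: "t \<in> carrier G"
  shows "compatible G G G (twisted_diag G a b X K) (twisted_char G a b X K \<kappa>)
      (twisted_diag G c d Y L) (twisted_char G c d Y L \<Lambda>) t \<longleftrightarrow> (\<forall>h\<in>K \<inter> L. \<kappa> h = \<Lambda> h)"
  using L t conj_set_normal[OF invariant_pairD(1)[OF L] t]
  by (simp add: compatible_def char1_twisted[OF L Y abcd(3,4)] char2_twisted[OF K X abcd(1,2)]
      invariant_pair_def)

end

subsection \<open>Composition of twisted diagonals\<close>

context group begin

text \<open>In the untwisted coordinates g', h', l' the relations g'K = h'K and h'L = l'L compose to
  equality modulo KL. The characters multiply because l'^-1 g' = (l'^-1 h')(h'^-1 g') and rho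
  extends both. A shared middle parameter b is essential here; the caller arranges it.\<close>

lemma twisted_relcomp:
  assumes K: "invariant_pair G K \<kappa>" and L: "invariant_pair G L \<Lambda>"
    and J: "invariant_pair G (K <#> L) \<rho>"
    and \<rho>: "\<And>k. k \<in> K \<Longrightarrow> \<rho> k = \<kappa> k" "\<And>l. l \<in> L \<Longrightarrow> \<rho> l = \<Lambda> l"
    and X: "subgroup X G" "K \<subseteq> X" "L \<subseteq> X" and Y: "subgroup Y G" "K \<subseteq> Y" "L \<subseteq> Y"
    and abe: "a \<in> carrier G" "b \<in> carrier G" "e \<in> carrier G"
  shows "twisted_diag G a b X K O twisted_diag G b e Y L = twisted_diag G a e (X \<inter> Y) (K <#> L)"
      (is "?A = ?B")
    and "star_char (twisted_diag G a b X K) (twisted_char G a b X K \<kappa>)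
        (twisted_diag G b e Y L) (twisted_char G b e Y L \<Lambda>) =
      twisted_char G a e (X \<inter> Y) (K <#> L) \<rho>"
proof -
  note DK = invariant_pairD[OF K] and DL = invariant_pairD[OF L] and DJ = invariant_pairD[OF J]
  have KL: "K \<subseteq> K <#> L" "L \<subseteq> K <#> L"
  proof -
    have "k \<otimes> \<one> \<in> K <#> L" if "k \<in> K" for k using that DL(4) by (auto simp: set_mult_def)
    then show "K \<subseteq> K <#> L" using DK(3) by (auto simp: subset_iff)
    have "\<one> \<otimes> l \<in> K <#> L" if "l \<in> L" for l using that DK(4) by (auto simp: set_mult_def)
    then show "L \<subseteq> K <#> L" using DL(3) by (auto simp: subset_iff)
  qed
  have split: "inv l' \<otimes> g' = (inv l' \<otimes> h') \<otimes> (inv h' \<otimes> g')"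
    if "g' \<in> carrier G" "h' \<in> carrier G" "l' \<in> carrier G" for g' h' l'
    using that by (simp add: m_assoc)
  show sets: "?A = ?B"
  proof (rule equalityI; rule subsetI)
    fix p assume "p \<in> ?A"
    then obtain g h l where p: "p = (g, l)" and U: "(g, h) \<in> twisted_diag G a b X K"
      and V: "(h, l) \<in> twisted_diag G b e Y L" by auto
    define g' h' l' where "g' = conj_elt G (inv a) g" and "h' = conj_elt G (inv b) h"
      and "l' = conj_elt G (inv e) l"
    note defs = g'_def h'_def l'_def
    have C: "g \<in> carrier G" "l \<in> carrier G" using U V by (auto simp: twisted_diag_def)
    have C': "g' \<in> carrier G" "h' \<in> carrier G" "l' \<in> carrier G"
      using U V abe by (auto simp: twisted_diag_def defs)
    have UX: "g' \<in> X" "h' \<in> X" "inv h' \<otimes> g' \<in> K" using U by (auto simp: twisted_diag_def defs)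
    have VY: "h' \<in> Y" "l' \<in> Y" "inv l' \<otimes> h' \<in> L" using V by (auto simp: twisted_diag_def defs)
    \<comment> \<open>Here K \<subseteq> Y puts g' into Y; next, L \<subseteq> X puts l' into
      X.\<close>
    have "h' \<otimes> (inv h' \<otimes> g') \<in> Y" by (rule subgroup.m_closed[OF Y(1)]) (use UX VY Y in auto)
    then have gY: "g' \<in> Y" using C' by simp
    have "h' \<otimes> inv (inv l' \<otimes> h') \<in> X"
      by (rule subgroup.m_closed[OF X(1)], use UX in simp, rule subgroup.m_inv_closed[OF X(1)])
         (use VY X in auto)
    then have lX: "l' \<in> X" using C' by (simp add: inv_mult_group)
    have "inv l' \<otimes> g' \<in> K <#> L"
      using split[OF C'] UX VY KL subgroup.m_closed[OF DJ(2)] by auto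
    then show "p \<in> ?B" using p C UX VY gY lX by (simp add: twisted_diag_def flip: defs)
  next
    fix p assume p: "p \<in> ?B"
    obtain g l where gl: "p = (g, l)" by (cases p)
    define g' l' where "g' = conj_elt G (inv a) g" and "l' = conj_elt G (inv e) l"
    note defs = g'_def l'_def
    have C: "g \<in> carrier G" "l \<in> carrier G" "g' \<in> carrier G" "l' \<in> carrier G"
      using p abe by (auto simp: twisted_diag_def defs gl)
    have B: "g' \<in> X" "g' \<in> Y" "l' \<in> X" "l' \<in> Y" "inv l' \<otimes> g' \<in> K <#> L"
      using p by (auto simp: twisted_diag_def defs gl)
    \<comment> \<open>Writing the inverse as k n places the K-factor next to g': then h' = g' k
      gives h'^-1 g' = k^-1 and l'^-1 h' = n^-1.\<close>
    have "inv (inv l' \<otimes> g') \<in> K <#> L" using B(5) by (rule subgroup.m_inv_closed[OF DJ(2)])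
    then obtain k n where kn: "k \<in> K" "n \<in> L" "inv (inv l' \<otimes> g') = k \<otimes> n"
      by (auto simp: set_mult_def)
    have knC: "k \<in> carrier G" "n \<in> carrier G" using kn DK(3) DL(3) by auto
    define h' where "h' = g' \<otimes> k"
    have h'C: "h' \<in> carrier G" using C knC by (simp add: h'_def)
    have hX: "h' \<in> X" using B kn X subgroup.m_closed[OF X(1)] by (auto simp: h'_def)
    have hY: "h' \<in> Y" using B kn Y subgroup.m_closed[OF Y(1)] by (auto simp: h'_def)
    have "inv h' \<otimes> g' = inv k" using C knC by (simp add: h'_def inv_mult_group m_assoc)
    then have hK: "inv h' \<otimes> g' \<in> K" using kn subgroup.m_inv_closed[OF DK(2)] by simp
    have "inv l' \<otimes> g' = inv n \<otimes> inv k"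
      using kn(3) C knC by (metis inv_closed inv_inv inv_mult_group m_closed)
    then have "inv l' \<otimes> h' = inv n"
      using C knC by (simp add: h'_def m_assoc[symmetric]) (simp add: m_assoc)
    then have hL: "inv l' \<otimes> h' \<in> L" using kn subgroup.m_inv_closed[OF DL(2)] by simp
    have "(g, conj_elt G b h') \<in> twisted_diag G a b X K"
      using C B h'C hX hK abe by (simp add: twisted_diag_def flip: defs)
    moreover have "(conj_elt G b h', l) \<in> twisted_diag G b e Y L"
      using C B h'C hY hL abe by (simp add: twisted_diag_def flip: defs)
    ultimately show "p \<in> ?A" using gl by auto
  qed
  show "star_char (twisted_diag G a b X K) (twisted_char G a b X K \<kappa>)
        (twisted_diag G b e Y L) (twisted_char G b e Y L \<Lambda>) =
      twisted_char G a e (X \<inter> Y) (K <#> L) \<rho>"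
    unfolding star_char_def twisted_char_def[of G a e]
  proof (rule restrict_cong_set[OF sets])
    fix p assume "p \<in> ?B"
    then have p: "p \<in> ?A" using sets by simp
    obtain g l where gl: "p = (g, l)" by (cases p)
    \<comment> \<open>The choice is harmless: the product of the two values is rho at l'^-1 g', in
      which h no longer occurs.\<close>
    define h where "h = (SOME h. (g, h) \<in> twisted_diag G a b X K \<and> (h, l) \<in> twisted_diag G b e Y L)"
    have "(g, h) \<in> twisted_diag G a b X K \<and> (h, l) \<in> twisted_diag G b e Y L"
      unfolding h_def by (rule someI_ex) (use p gl in blast)
    then have h: "(g, h) \<in> twisted_diag G a b X K" "(h, l) \<in> twisted_diag G b e Y L" by auto
    define g' h' l' where "g' = conj_elt G (inv a) g" and "h' = conj_elt G (inv b) h"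
      and "l' = conj_elt G (inv e) l"
    note defs = g'_def h'_def l'_def
    have C': "g' \<in> carrier G" "h' \<in> carrier G" "l' \<in> carrier G"
      using h abe by (auto simp: twisted_diag_def defs)
    have m: "inv h' \<otimes> g' \<in> K" "inv l' \<otimes> h' \<in> L" using h by (auto simp: twisted_diag_def defs)
    have "\<rho> (inv l' \<otimes> g') = \<rho> (inv l' \<otimes> h') * \<rho> (inv h' \<otimes> g')"
      unfolding split[OF C'] by (rule DJ(6)) (use m KL in auto)
    also have "\<dots> = \<kappa> (inv h' \<otimes> g') * \<Lambda> (inv l' \<otimes> h')" using \<rho> m by simp
    finally have "\<rho> (inv l' \<otimes> g') =
        twisted_char G a b X K \<kappa> (g, h) * twisted_char G b e Y L \<Lambda> (h, l)"
      using h by (simp add: twisted_char_def defs)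
    then show "(case p of (g, l) \<Rightarrow>
        let h = SOME h. (g, h) \<in> twisted_diag G a b X K \<and> (h, l) \<in> twisted_diag G b e Y L
        in twisted_char G a b X K \<kappa> (g, h) * twisted_char G b e Y L \<Lambda> (h, l)) =
      (case p of (g, h) \<Rightarrow> \<rho> (inv (conj_elt G (inv e) h) \<otimes> conj_elt G (inv a) g))"
      by (simp add: gl defs flip: h_def)
  qed
qed

lemma double_coset_reps_subset:
  assumes "subgroup P G" "subgroup Q G"
  shows "double_coset_reps G P Q \<subseteq> carrier G"
proof
  fix s assume "s \<in> double_coset_reps G P Q"
  then obtain t where t: "t \<in> carrier G" "s = (SOME s. s \<in> P <#> (t <# Q))"
    by (auto simp: double_coset_reps_def double_cosets_def)
  have "s \<in> P <#> (t <# Q)" unfolding t(2) using double_coset_self[OF assms t(1)] by (rule someI)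
  then show "s \<in> carrier G"
    using subgroup.mem_carrier[OF assms(1)] subgroup.mem_carrier[OF assms(2)] t(1)
    by (auto simp: mem_double_coset_iff)
qed

lemma pair_comp_twisted_incompatible:
  assumes K: "invariant_pair G K \<kappa>" and X: "subgroup X G" "K \<subseteq> X"
    and L: "invariant_pair G L \<Lambda>" and Y: "subgroup Y G" "L \<subseteq> Y"
    and abcd: "a \<in> carrier G" "b \<in> carrier G" "c \<in> carrier G" "d \<in> carrier G"
    and "\<not> (\<forall>h\<in>K \<inter> L. \<kappa> h = \<Lambda> h)"
  shows "pair_comp G G G (twisted_diag G a b X K) (twisted_char G a b X K \<kappa>)
      (twisted_diag G c d Y L) (twisted_char G c d Y L \<Lambda>) = 0"
proof -
  have XY: "X \<subseteq> carrier G" "Y \<subseteq> carrier G" using X Y by (simp_all add: subgroup.subset)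
  have "double_coset_reps G (p2 (twisted_diag G a b X K)) (p1 (twisted_diag G c d Y L)) \<subseteq> carrier G"
    using X Y abcd double_coset_reps_subset subgroup_conj_set
    by (simp add: p1_twisted_diag[OF L XY(2) abcd(3,4)] p2_twisted_diag[OF K XY(1) abcd(1,2)])
  then have none: "{t \<in> double_coset_reps G (p2 (twisted_diag G a b X K)) (p1 (twisted_diag G c d Y L)).
      compatible G G G (twisted_diag G a b X K) (twisted_char G a b X K \<kappa>)
        (twisted_diag G c d Y L) (twisted_char G c d Y L \<Lambda>) t} = {}"
    using compatible_twisted[OF K X L Y abcd] assms(11) by auto
  show ?thesis unfolding pair_comp_def none by simp
qed

text \<open>For arbitrary representatives of the two classes, each summand is brought to the
  situation of \<open>twisted_relcomp\<close> and the sum over double cosets is spread over the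
  group. The substitution w = b^-1 t c then removes the parameters from the result.\<close>

lemma pair_comp_twisted:
  assumes fin: "finite (carrier G)"
    and K: "invariant_pair G K \<kappa>" and L: "invariant_pair G L \<Lambda>"
    and J: "invariant_pair G (K <#> L) \<rho>"
    and \<rho>: "\<And>k. k \<in> K \<Longrightarrow> \<rho> k = \<kappa> k" "\<And>l. l \<in> L \<Longrightarrow> \<rho> l = \<Lambda> l"
    and X: "subgroup X G" "K \<subseteq> X" "L \<subseteq> X" and Y: "subgroup Y G" "K \<subseteq> Y" "L \<subseteq> Y"
    and abcd: "a \<in> carrier G" "b \<in> carrier G" "c \<in> carrier G" "d \<in> carrier G"
  shows "scale (int_embed (int (card X * card Y)))
      (pair_comp G G G (twisted_diag G a b X K) (twisted_char G a b X K \<kappa>)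
        (twisted_diag G c d Y L) (twisted_char G c d Y L \<Lambda>)) =
    (\<Sum>w\<in>carrier G. scale (int_embed (int (card (X \<inter> conj_set G w Y))))
      (Poly_Mapping.single (twisted_class G (X \<inter> conj_set G w Y) (K <#> L) \<rho>)
        (1::'k::{comm_ring,comm_monoid_mult})))"
proof -
  have XY: "X \<subseteq> carrier G" "Y \<subseteq> carrier G" using X Y by (simp_all add: subgroup.subset)
  define F where "F w = (Poly_Mapping.single
    (twisted_class G (X \<inter> conj_set G w Y) (K <#> L) \<rho>) 1 :: _ \<Rightarrow>\<^sub>0 'k)" for w
  \<comment> \<open>After the shift by (t, 1) the second factor has left parameter t c = b (W t), so
    W t is what separates it from the required middle parameter b.\<close>
  define W where "W t = inv b \<otimes> (t \<otimes> c)" for t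
  let ?P = "conj_set G b X" and ?Q = "conj_set G c Y"
  let ?U = "twisted_diag G a b X K" and ?\<upsilon> = "twisted_char G a b X K \<kappa>"
  let ?V = "twisted_diag G c d Y L" and ?\<omega> = "twisted_char G c d Y L \<Lambda>"
  have W: "W t \<in> carrier G" if "t \<in> carrier G" for t using that abcd by (simp add: W_def)
  have PQ: "subgroup ?P G" "subgroup ?Q G" using X Y abcd subgroup_conj_set by auto
  have proj: "p2 ?U = ?P" "p1 ?V = ?Q"
    by (rule p2_twisted_diag[OF K XY(1) abcd(1,2)], rule p1_twisted_diag[OF L XY(2) abcd(3,4)])
  have reps: "double_coset_reps G ?P ?Q \<subseteq> carrier G" by (rule double_coset_reps_subset[OF PQ])
  have compat: "\<forall>h\<in>K \<inter> L. \<kappa> h = \<Lambda> h" using \<rho> by force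
  have summand: "fib_basis G G (?U O conj_set (G \<times>\<times> G) (t, \<one>) ?V)
      (star_char ?U ?\<upsilon> (conj_set (G \<times>\<times> G) (t, \<one>) ?V) (conj_char (G \<times>\<times> G) (t, \<one>) ?V ?\<omega>)) = F (W t)"
    if t: "t \<in> carrier G" for t
  proof -
    \<comment> \<open>With this value both parameters (t c, d) = (b, ?e)(W t) carry the common right
      factor W t, which is moved into Y.\<close>
    let ?e = "d \<otimes> inv (W t)" and ?Y = "conj_set G (W t) Y"
    have eqs: "t \<otimes> c = b \<otimes> W t" "\<one> \<otimes> d = ?e \<otimes> W t"
      using t abcd by (simp_all add: W_def m_assoc)
    have e: "?e \<in> carrier G" using W[OF t] abcd by simp
    have V': "conj_set (G \<times>\<times> G) (t, \<one>) ?V = twisted_diag G b ?e ?Y L"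
      "conj_char (G \<times>\<times> G) (t, \<one>) ?V ?\<omega> = twisted_char G b ?e ?Y L \<Lambda>"
      using twisted_conj_set[OF L XY(2) abcd(2) e W[OF t]] t abcd
      by (simp_all only: conj_set_twisted_diag conj_char_twisted_char one_closed eqs)
    have Y': "subgroup ?Y G" "K \<subseteq> ?Y" "L \<subseteq> ?Y"
    proof -
      show "subgroup ?Y G" by (rule subgroup_conj_set[OF W[OF t] Y(1)])
      have "conj_set G (W t) K \<subseteq> ?Y" "conj_set G (W t) L \<subseteq> ?Y"
        using Y unfolding conj_set_conj_elt by blast+
      then show "K \<subseteq> ?Y" "L \<subseteq> ?Y"
        using conj_set_normal[OF invariant_pairD(1)[OF K] W[OF t]]
          conj_set_normal[OF invariant_pairD(1)[OF L] W[OF t]] by simp_all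
    qed
    have comp: "?U O twisted_diag G b ?e ?Y L = twisted_diag G a ?e (X \<inter> ?Y) (K <#> L)"
      "star_char ?U ?\<upsilon> (twisted_diag G b ?e ?Y L) (twisted_char G b ?e ?Y L \<Lambda>) =
        twisted_char G a ?e (X \<inter> ?Y) (K <#> L) \<rho>"
      by (rule twisted_relcomp[OF K L J]; use \<rho> X Y' abcd e in simp)+
    show ?thesis
      unfolding V' comp fib_basis_def F_def fib_class_twisted[OF abcd(1) e] ..
  qed
  have "pair_comp G G G ?U ?\<upsilon> ?V ?\<omega> = (\<Sum>t\<in>double_coset_reps G ?P ?Q. F (W t))"
    unfolding pair_comp_def proj Let_def
  proof (rule sum.cong)
    show "{t \<in> double_coset_reps G ?P ?Q. compatible G G G ?U ?\<upsilon> ?V ?\<omega> t} =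
        double_coset_reps G ?P ?Q"
      using compatible_twisted[OF K X(1,2) L Y(1,3) abcd] compat reps by auto
  qed (use summand reps in auto)
  moreover have "scale (int_embed (int (card ?P * card ?Q)))
      (\<Sum>t\<in>double_coset_reps G ?P ?Q. F (W t)) =
    (\<Sum>t\<in>carrier G. scale (int_embed (int (card (?P \<inter> conj_set G t ?Q)))) (F (W t)))"
  proof (rule sum_double_coset_reps[OF PQ fin])
    \<comment> \<open>Changing t within its double coset turns W t into x' (W t) y' with x' in X and
      y' in Y. Here y' normalizes Y, and x' conjugates the whole intersection, which leaves the
      class unchanged.\<close>
    fix x t y assume x: "x \<in> ?P" and y: "y \<in> ?Q" and t: "t \<in> carrier G"
    obtain x' y' where x': "x' \<in> X" "x = conj_elt G b x'" and y': "y' \<in> Y" "y = conj_elt G c y'"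
      using x y by (auto simp: conj_set_conj_elt)
    have C: "x' \<in> carrier G" "y' \<in> carrier G" using x' y' XY by auto
    have "W (x \<otimes> (t \<otimes> y)) = x' \<otimes> (W t \<otimes> y')"
      using C t abcd by (simp add: W_def x' y' conj_elt_def m_assoc)
    then have "conj_set G (W (x \<otimes> (t \<otimes> y))) Y = conj_set G x' (conj_set G (W t) (conj_set G y' Y))"
      using C W[OF t] XY by (simp add: conj_set_conj_set conj_set_subset)
    also have "conj_set G y' Y = Y" by (rule conj_set_self[OF Y(1) y'(1)])
    finally have "X \<inter> conj_set G (W (x \<otimes> (t \<otimes> y))) Y =
        conj_set G x' X \<inter> conj_set G x' (conj_set G (W t) Y)"
      using conj_set_self[OF X(1) x'(1)] by simp
    also have "\<dots> = conj_set G x' (X \<inter> conj_set G (W t) Y)"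
      using C W[OF t] XY by (simp add: conj_set_Int conj_set_subset)
    finally show "F (W (x \<otimes> (t \<otimes> y))) = F (W t)"
      unfolding F_def using XY C by (simp add: twisted_class_conj_set[OF J] le_infI1)
  qed
  moreover have "card ?P = card X" "card ?Q = card Y" using XY abcd by (simp_all add: card_conj_set)
  moreover have "card (?P \<inter> conj_set G t ?Q) = card (X \<inter> conj_set G (W t) Y)"
    if t: "t \<in> carrier G" for t
  proof -
    have "t \<otimes> c = b \<otimes> W t" using t abcd by (simp add: W_def)
    then have "conj_set G t ?Q = conj_set G b (conj_set G (W t) Y)"
      using t abcd W[OF t] XY by (simp add: conj_set_conj_set)
    then have "?P \<inter> conj_set G t ?Q = conj_set G b (X \<inter> conj_set G (W t) Y)"
      using abcd W[OF t] XY by (simp add: conj_set_Int conj_set_subset)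
    then show ?thesis using abcd XY by (simp add: card_conj_set le_infI1)
  qed
  ultimately have "scale (int_embed (int (card X * card Y))) (pair_comp G G G ?U ?\<upsilon> ?V ?\<omega>) =
    (\<Sum>t\<in>carrier G. scale (int_embed (int (card (X \<inter> conj_set G (W t) Y)))) (F (W t)))"
    by simp
  also have "\<dots> = (\<Sum>w\<in>carrier G. scale (int_embed (int (card (X \<inter> conj_set G w Y)))) (F w))"
    using abcd by (intro sum.reindex_bij_witness[of _ "\<lambda>w. b \<otimes> (w \<otimes> inv c)" W])
      (simp_all add: W_def m_assoc)
  finally show ?thesis by (simp add: F_def)
qed

end

text \<open>The weight \<open>|X|\<close> turns a sum over double cosets into a sum over all group elements, see
  \<open>weighted_class_mult\<close>.\<close>

definition weighted_class :: "('a, 'm) monoid_scheme \<Rightarrow> 'a set \<Rightarrow> 'a set \<times> ('a \<Rightarrow> complex)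
    \<Rightarrow> (('a, 'a) fib_class \<Rightarrow>\<^sub>0 'k::{comm_ring,comm_monoid_mult})" where
  "weighted_class G X p = scale (int_embed (int (card X)))
     (Poly_Mapping.single (twisted_class G X (fst p) (snd p)) 1)"

definition compatible_pairs :: "'a set \<times> ('a \<Rightarrow> complex) \<Rightarrow> 'a set \<times> ('a \<Rightarrow> complex) \<Rightarrow> bool" where
  "compatible_pairs p q \<longleftrightarrow> (\<forall>h\<in>fst p \<inter> fst q. snd p h = snd q h)"

context group begin

text \<open>The representatives picked in \<open>class_comp\<close> are unknown conjugates, so a
  property of the product must be checked for all parameters. \<open>R\<close> is instantiated with
  the product formula and with being zero.\<close>

lemma class_comp_twisted_class:
  assumes "\<And>a b c d. \<lbrakk>a \<in> carrier G; b \<in> carrier G; c \<in> carrier G; d \<in> carrier G\<rbrakk> \<Longrightarrow>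
    R (pair_comp G G G (twisted_diag G a b X K) (twisted_char G a b X K \<kappa>)
        (twisted_diag G c d Y L) (twisted_char G c d Y L \<Lambda>))"
  shows "R (class_comp G G G (twisted_class G X K \<kappa>) (twisted_class G Y L \<Lambda>))"
proof -
  have some: "\<exists>a b. a \<in> carrier G \<and> b \<in> carrier G \<and>
    (SOME p. p \<in> twisted_class G X K \<kappa>) = (twisted_diag G a b X K, twisted_char G a b X K \<kappa>)" for X K \<kappa>
  proof -
    have "(twisted_diag G \<one> \<one> X K, twisted_char G \<one> \<one> X K \<kappa>) \<in> twisted_class G X K \<kappa>"
      unfolding twisted_class_def by blast
    then have "(SOME p. p \<in> twisted_class G X K \<kappa>) \<in> twisted_class G X K \<kappa>" by (rule someI)
    then show ?thesis unfolding twisted_class_def by blast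
  qed
  obtain a b c d where "a \<in> carrier G" "b \<in> carrier G" "c \<in> carrier G" "d \<in> carrier G"
    "(SOME p. p \<in> twisted_class G X K \<kappa>) = (twisted_diag G a b X K, twisted_char G a b X K \<kappa>)"
    "(SOME p. p \<in> twisted_class G Y L \<Lambda>) = (twisted_diag G c d Y L, twisted_char G c d Y L \<Lambda>)"
    using some[of X K \<kappa>] some[of Y L \<Lambda>] by auto
  then show ?thesis using assms[of a b c d] by (simp add: class_comp_def)
qed

lemma frattini_pairs_iff:
  "p \<in> frattini_pairs G \<longleftrightarrow> invariant_pair G (fst p) (snd p) \<and> fst p \<subseteq> frattini G"
  by (cases p) (auto simp: frattini_pairs_def invariant_pair_def)

lemma weighted_class_mult:
  assumes fin: "finite (carrier G)"
    and p: "p \<in> frattini_pairs G" and q: "q \<in> frattini_pairs G" and r: "r \<in> frattini_pairs G"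
    and r_eq: "fst r = fst p <#> fst q" and le: "pair_le p r" "pair_le q r"
    and X: "subgroup X G" "frattini G \<subseteq> X" and Y: "subgroup Y G" "frattini G \<subseteq> Y"
  shows "fib_mult G (weighted_class G X p) (weighted_class G Y q) =
    (\<Sum>w\<in>carrier G. weighted_class G (X \<inter> conj_set G w Y) r)"
proof -
  have val: "snd r k = snd p k" if "k \<in> fst p" for k
    using le(1) that by (metis pair_le_def restrict_apply)
  have val': "snd r k = snd q k" if "k \<in> fst q" for k
    using le(2) that by (metis pair_le_def restrict_apply)
  have "fib_mult G (weighted_class G X p) (weighted_class G Y q) =
    scale (int_embed (int (card X * card Y)))
      (class_comp G G G (twisted_class G X (fst p) (snd p)) (twisted_class G Y (fst q) (snd q)))"
    by (simp add: weighted_class_def fib_comp_scale_left fib_comp_scale_right fib_comp_single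
        scale_scale int_embed_mult mult.commute)
  also have "\<dots> = (\<Sum>w\<in>carrier G. weighted_class G (X \<inter> conj_set G w Y) r)"
    unfolding weighted_class_def r_eq
    by (rule class_comp_twisted_class[where R = "\<lambda>x. scale _ x = _"], rule pair_comp_twisted)
       (use assms val val' in \<open>auto simp: frattini_pairs_iff\<close>)
  finally show ?thesis .
qed

lemma weighted_class_mult_incompatible:
  assumes p: "p \<in> frattini_pairs G" and q: "q \<in> frattini_pairs G"
    and "\<not> compatible_pairs p q"
    and X: "subgroup X G" "frattini G \<subseteq> X" and Y: "subgroup Y G" "frattini G \<subseteq> Y"
  shows "fib_mult G (weighted_class G X p) (weighted_class G Y q) =
    (0 :: _ \<Rightarrow>\<^sub>0 'k::{comm_ring,comm_monoid_mult})"
proof -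
  have "class_comp G G G (twisted_class G X (fst p) (snd p)) (twisted_class G Y (fst q) (snd q)) =
      (0 :: _ \<Rightarrow>\<^sub>0 'k)"
    by (rule class_comp_twisted_class[where R = "\<lambda>x. x = 0"], rule pair_comp_twisted_incompatible)
       (use assms in \<open>auto simp: frattini_pairs_iff compatible_pairs_def\<close>)
  then show ?thesis
    by (simp add: weighted_class_def fib_comp_scale_left fib_comp_scale_right fib_comp_single)
qed

end

subsection \<open>The poset of Frattini pairs\<close>

definition trivial_pair :: "('a, 'm) monoid_scheme \<Rightarrow> 'a set \<times> ('a \<Rightarrow> complex)" where
  "trivial_pair G = ({\<one>\<^bsub>G\<^esub>}, \<lambda>x\<in>{\<one>\<^bsub>G\<^esub>}. 1)"

lemma pair_le_refl: "snd p \<in> extensional (fst p) \<Longrightarrow> pair_le p p"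
  by (simp add: pair_le_def extensional_restrict)

lemma pair_le_apply: "pair_le p q \<Longrightarrow> k \<in> fst p \<Longrightarrow> snd q k = snd p k"
  by (metis pair_le_def restrict_apply)

lemma pair_leI:
  assumes "fst p \<subseteq> fst q" "snd p \<in> extensional (fst p)" "\<And>k. k \<in> fst p \<Longrightarrow> snd q k = snd p k"
  shows "pair_le p q"
  unfolding pair_le_def using assms by (auto intro: extensionalityI)

lemma pair_le_trans: "pair_le p q \<Longrightarrow> pair_le q r \<Longrightarrow> pair_le p r"
  by (auto simp: pair_le_def) (metis Int_absorb1 restrict_restrict)

lemma pair_le_fst_eq: "pair_le p q \<Longrightarrow> snd q \<in> extensional (fst q) \<Longrightarrow> fst p = fst q \<Longrightarrow> p = q"
  by (auto simp: pair_le_def extensional_restrict prod_eq_iff)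

section \<open>Closure properties of the free module\<close>

lemma fib_module_zero: "0 \<in> fib_module G H"
  by (simp add: fib_module_def)

lemma fib_module_add: "a \<in> fib_module G H \<Longrightarrow> b \<in> fib_module G H \<Longrightarrow> a + b \<in> fib_module G H"
  using Poly_Mapping.keys_add[of a b] by (auto simp: fib_module_def)

lemma fib_module_scale: "a \<in> fib_module G H \<Longrightarrow> scale c a \<in> fib_module G H"
  using keys_scale[of c a] by (auto simp: fib_module_def)

lemma fib_module_sum: "(\<And>x. x \<in> A \<Longrightarrow> f x \<in> fib_module G H) \<Longrightarrow> sum f A \<in> fib_module G H"
  by (induction A rule: infinite_finite_induct) (simp_all add: fib_module_zero fib_module_add)

context group begin

lemma invariant_pairI:
  assumes K: "K \<lhd> G" and "\<kappa> \<in> extensional K"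
    and "\<And>k l. k \<in> K \<Longrightarrow> l \<in> K \<Longrightarrow> \<kappa> (k \<otimes> l) = \<kappa> k * \<kappa> l"
    and "\<And>k. k \<in> K \<Longrightarrow> \<kappa> k \<noteq> 0"
    and "\<And>g k. g \<in> carrier G \<Longrightarrow> k \<in> K \<Longrightarrow> \<kappa> (conj_elt G g k) = \<kappa> k"
  shows "invariant_pair G K \<kappa>"
proof -
  have "conj_char G g K \<kappa> = \<kappa>" if g: "g \<in> carrier G" for g
  proof -
    have "conj_char G g K \<kappa> = restrict \<kappa> K"
      unfolding conj_char_def
    proof (rule restrict_cong_set[OF conj_set_normal[OF K g]])
      fix k assume "k \<in> K"
      then show "\<kappa> (inv g \<otimes> k \<otimes> g) = \<kappa> k" using assms(5)[of "inv g" k] g by (simp add: conj_elt_def)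
    qed
    then show ?thesis using assms(2) by (simp add: extensional_restrict)
  qed
  then show ?thesis using assms by (auto simp: invariant_pair_def dual_def hom_def Cx_def)
qed

lemma frattini_pairsD:
  assumes "p \<in> frattini_pairs G"
  shows "invariant_pair G (fst p) (snd p)" "fst p \<subseteq> frattini G" "snd p \<in> extensional (fst p)"
    "fst p \<lhd> G" "subgroup (fst p) G" "fst p \<subseteq> carrier G"
  using assms invariant_pairD[of "fst p" "snd p"] by (auto simp: frattini_pairs_iff)

text \<open>Characters of K take values in the |K|-th roots of unity, by Lagrange, and are
  extensional; so they lie in a finite function space.\<close>

lemma finite_dual:
  assumes fin: "finite (carrier G)" and K: "subgroup K G"
  shows "finite (dual G K)"
proof -
  interpret K: group "G\<lparr>carrier := K\<rparr>" by (rule subgroup.subgroup_is_group[OF K is_group])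
  have finK: "finite K" using subgroup.subset[OF K] fin finite_subset by blast
  have "K \<noteq> {}" using subgroup.one_closed[OF K] by blast
  then have pos: "card K \<ge> 1" using finK by (simp add: Suc_leI card_gt_0_iff)
  have root: "f x ^ card K = 1" if f: "f \<in> dual G K" and x: "x \<in> K" for f x
  proof -
    have hom: "f \<in> hom (G\<lparr>carrier := K\<rparr>) Cx" using f by (simp add: dual_def)
    have one: "f \<one> = 1"
    proof -
      have "\<And>x y. x \<in> K \<Longrightarrow> y \<in> K \<Longrightarrow> f (x \<otimes> y) = f x * f y" "f \<one> \<noteq> 0"
        using hom subgroup.one_closed[OF K] by (auto simp: hom_def Cx_def Pi_iff)
      from this(1)[of \<one> \<one>] this(2) show ?thesis using subgroup.one_closed[OF K] by simp
    qed
    have pow: "f (x [^]\<^bsub>G\<lparr>carrier := K\<rparr>\<^esub> n) = f x ^ n" for n :: nat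
    proof (induction n)
      case (Suc n)
      have "x [^]\<^bsub>G\<lparr>carrier := K\<rparr>\<^esub> n \<in> K" using K.nat_pow_closed[of x n] x by simp
      then show ?case using Suc hom x by (simp add: hom_def Cx_def)
    qed (simp add: one)
    have "x [^]\<^bsub>G\<lparr>carrier := K\<rparr>\<^esub> card K = \<one>"
      using K.pow_order_eq_1[of x] x by (simp add: order_def)
    then show ?thesis using pow[of "card K"] one by simp
  qed
  have "dual G K \<subseteq> (\<Pi>\<^sub>E x\<in>K. {z. z ^ card K = 1})"
    using root by (auto simp: dual_def PiE_def)
  moreover have "finite (\<Pi>\<^sub>E x\<in>K. {z::complex. z ^ card K = 1})"
    using finK pos by (intro finite_PiE finite_roots_unity) auto
  ultimately show ?thesis by (rule finite_subset)
qed

lemma finite_frattini_pairs: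
  assumes fin: "finite (carrier G)"
  shows "finite (frattini_pairs G)"
proof (rule finite_subset)
  show "frattini_pairs G \<subseteq> Sigma {K. subgroup K G} (dual G)"
    by (auto simp: frattini_pairs_def normal_imp_subgroup)
  show "finite (Sigma {K. subgroup K G} (dual G))"
    using finite_subgroups[OF fin] finite_dual[OF fin] by (intro finite_SigmaI) auto
qed

lemma trivial_pair_in: "trivial_pair G \<in> frattini_pairs G"
proof -
  have "invariant_pair G {\<one>} (\<lambda>x\<in>{\<one>}. 1)"
    by (rule invariant_pairI) (auto simp: one_is_normal)
  moreover have "{\<one>} \<subseteq> frattini G" using subgroup.one_closed[OF frattini_subgroup] by simp
  ultimately show ?thesis by (simp add: frattini_pairs_iff trivial_pair_def)
qed

lemma trivial_pair_le:
  assumes "p \<in> frattini_pairs G"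
  shows "pair_le (trivial_pair G) p"
  using invariant_pairD(4,8)[OF frattini_pairsD(1)[OF assms]]
  by (intro pair_leI) (auto simp: trivial_pair_def)

lemma restrict_frattini_pair:
  assumes s: "s \<in> frattini_pairs G" and M: "M \<lhd> G" "M \<subseteq> fst s"
  shows "(M, restrict (snd s) M) \<in> frattini_pairs G"
proof -
  note D = invariant_pairD[OF frattini_pairsD(1)[OF s]]
  have "invariant_pair G M (restrict (snd s) M)"
  proof (rule invariant_pairI[OF M(1)])
    fix g k assume g: "g \<in> carrier G" and k: "k \<in> M"
    then have "conj_elt G g k \<in> M"
      using normal_conj_elt_iff[OF M(1) g] M D(3) by blast
    then show "restrict (snd s) M (conj_elt G g k) = restrict (snd s) M k"
      using D(10)[OF g] k M by auto
  next
    fix k l assume kl: "k \<in> M" "l \<in> M"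
    then have "k \<otimes> l \<in> M" by (rule subgroup.m_closed[OF normal_imp_subgroup[OF M(1)]])
    then show "restrict (snd s) M (k \<otimes> l) = restrict (snd s) M k * restrict (snd s) M l"
      using kl M D(6)[of k l] by auto
  qed (use M D(7) in auto)
  then show ?thesis using M frattini_pairsD(2)[OF s] by (auto simp: frattini_pairs_iff)
qed

text \<open>The character k l \<mapsto> kappa(k) lambda(l) on KL is well defined because the two
  characters agree on K \<inter> L, and it is multiplicative because kappa is G-invariant.\<close>

lemma pair_join_exists:
  assumes p: "p \<in> frattini_pairs G" and q: "q \<in> frattini_pairs G" and c: "compatible_pairs p q"
  obtains r where "r \<in> frattini_pairs G" "fst r = fst p <#> fst q" "pair_le p r" "pair_le q r"
proof -
  obtain K \<kappa> L \<Lambda> where p_eq: "p = (K, \<kappa>)" and q_eq: "q = (L, \<Lambda>)" by (cases p, cases q)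
  have K: "invariant_pair G K \<kappa>" "K \<subseteq> frattini G" and L: "invariant_pair G L \<Lambda>" "L \<subseteq> frattini G"
    using p q by (simp_all add: frattini_pairs_iff p_eq q_eq)
  note DK = invariant_pairD[OF K(1)] and DL = invariant_pairD[OF L(1)]
  note CK = subgroup.mem_carrier[OF DK(2)] and CL = subgroup.mem_carrier[OF DL(2)]
  have agree: "\<kappa> z = \<Lambda> z" if "z \<in> K" "z \<in> L" for z
    using c that by (simp add: compatible_pairs_def p_eq q_eq)
  \<comment> \<open>The chosen k is the K-part of one factorization of x.\<close>
  define \<rho> where "\<rho> = (\<lambda>x\<in>K <#> L. let k = SOME k. k \<in> K \<and> inv k \<otimes> x \<in> L in \<kappa> k * \<Lambda> (inv k \<otimes> x))"
  have \<rho>: "\<rho> (k \<otimes> l) = \<kappa> k * \<Lambda> l" if k: "k \<in> K" and l: "l \<in> L" for k l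
  proof -
    define n where "n = (SOME n. n \<in> K \<and> inv n \<otimes> (k \<otimes> l) \<in> L)"
    have ex: "k \<in> K \<and> inv k \<otimes> (k \<otimes> l) \<in> L" using k l CK CL by simp
    have n: "n \<in> K \<and> inv n \<otimes> (k \<otimes> l) \<in> L" unfolding n_def by (rule someI, rule ex)
    \<comment> \<open>Two factorizations of the same element differ by z, which lies in K \<inter>
      L, where the characters agree.\<close>
    define z where "z = inv n \<otimes> k"
    have C: "n \<in> carrier G" "k \<in> carrier G" "l \<in> carrier G" using n k l CK CL by auto
    have zK: "z \<in> K"
      using n k subgroup.m_closed[OF DK(2)] subgroup.m_inv_closed[OF DK(2)] by (simp add: z_def)
    have "(inv n \<otimes> (k \<otimes> l)) \<otimes> inv l \<in> L"
      using n l subgroup.m_closed[OF DL(2)] subgroup.m_inv_closed[OF DL(2)] by simp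
    moreover have "(inv n \<otimes> (k \<otimes> l)) \<otimes> inv l = z" using C by (simp add: z_def m_assoc)
    ultimately have zL: "z \<in> L" by simp
    have eqs: "inv n \<otimes> (k \<otimes> l) = z \<otimes> l" "k = n \<otimes> z" using C by (simp_all add: z_def m_assoc)
    have "k \<otimes> l \<in> K <#> L" using k l by (auto simp: set_mult_def)
    then have "\<rho> (k \<otimes> l) = \<kappa> n * \<Lambda> (inv n \<otimes> (k \<otimes> l))" by (simp add: \<rho>_def flip: n_def)
    also have "\<dots> = \<kappa> n * \<Lambda> z * \<Lambda> l" using DL(6)[OF zL l] by (simp add: eqs(1))
    also have "\<dots> = \<kappa> (n \<otimes> z) * \<Lambda> l" using DK(6)[of n z] n zK agree[OF zK zL] by simp
    finally show ?thesis by (simp flip: eqs(2))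
  qed
  have \<rho>K: "\<rho> k = \<kappa> k" if "k \<in> K" for k using \<rho>[OF that DL(4)] that CK DL(8) by simp
  have \<rho>L: "\<rho> l = \<Lambda> l" if "l \<in> L" for l using \<rho>[OF DK(4) that] that CL DK(8) by simp
  have J: "K <#> L \<lhd> G" by (rule normal_subgroup_set_mult_closed[OF DK(1) DL(1)])
  have obt: "\<exists>k l. k \<in> K \<and> l \<in> L \<and> x = k \<otimes> l" if "x \<in> K <#> L" for x
    using that by (auto simp: set_mult_def)
  have "invariant_pair G (K <#> L) \<rho>"
  proof (rule invariant_pairI[OF J])
    fix x y assume "x \<in> K <#> L" "y \<in> K <#> L"
    then obtain k l k' l' where kl: "k \<in> K" "l \<in> L" "x = k \<otimes> l" and kl': "k' \<in> K" "l' \<in> L" "y = k' \<otimes> l'"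
      using obt by metis
    have C: "k \<in> carrier G" "l \<in> carrier G" "k' \<in> carrier G" "l' \<in> carrier G"
      using kl kl' CK CL by auto
    have cK: "conj_elt G l k' \<in> K" using normal_conj_elt_iff[OF DK(1) C(2,3)] kl' by simp
    \<comment> \<open>Moving k' to the left past l conjugates it by l, and kappa does not see
      this.\<close>
    have "x \<otimes> y = (k \<otimes> conj_elt G l k') \<otimes> (l \<otimes> l')"
      using C by (simp add: kl kl' conj_elt_def m_assoc)
    moreover have "k \<otimes> conj_elt G l k' \<in> K" "l \<otimes> l' \<in> L"
      using kl kl' cK subgroup.m_closed[OF DK(2)] subgroup.m_closed[OF DL(2)] by auto
    ultimately have "\<rho> (x \<otimes> y) = \<kappa> (k \<otimes> conj_elt G l k') * \<Lambda> (l \<otimes> l')" using \<rho> by simp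
    also have "\<dots> = \<kappa> k * \<kappa> k' * (\<Lambda> l * \<Lambda> l')"
      using DK(6)[OF kl(1) cK] DK(10)[OF C(2) kl'(1)] DL(6)[OF kl(2) kl'(2)] by simp
    finally show "\<rho> (x \<otimes> y) = \<rho> x * \<rho> y" using \<rho> kl kl' by simp
  next
    fix x assume "x \<in> K <#> L"
    then obtain k l where "k \<in> K" "l \<in> L" "x = k \<otimes> l" using obt by metis
    then show "\<rho> x \<noteq> 0" using \<rho> DK(7) DL(7) by simp
  next
    fix g x assume g: "g \<in> carrier G" and "x \<in> K <#> L"
    then obtain k l where kl: "k \<in> K" "l \<in> L" "x = k \<otimes> l" using obt by metis
    have "conj_elt G g x = conj_elt G g k \<otimes> conj_elt G g l" using g kl CK CL by (simp add: conj_elt_mult)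
    moreover have "conj_elt G g k \<in> K" "conj_elt G g l \<in> L"
      using normal_conj_elt_iff[OF DK(1) g] normal_conj_elt_iff[OF DL(1) g] kl CK CL by auto
    ultimately show "\<rho> (conj_elt G g x) = \<rho> x"
      using \<rho> kl DK(10)[OF g] DL(10)[OF g] by simp
  qed (simp add: \<rho>_def)
  moreover have "K <#> L \<subseteq> frattini G"
    using K(2) L(2) subgroup.m_closed[OF frattini_subgroup] by (auto simp: set_mult_def)
  ultimately have "(K <#> L, \<rho>) \<in> frattini_pairs G" by (simp add: frattini_pairs_iff)
  moreover have "pair_le p (K <#> L, \<rho>)"
  proof (rule pair_leI)
    have "k \<otimes> \<one> \<in> K <#> L" if "k \<in> K" for k using that DL(4) by (auto simp: set_mult_def)
    then show "fst p \<subseteq> fst (K <#> L, \<rho>)" using CK by (auto simp: p_eq)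
  qed (use DK(5) \<rho>K p_eq in auto)
  moreover have "pair_le q (K <#> L, \<rho>)"
  proof (rule pair_leI)
    have "\<one> \<otimes> l \<in> K <#> L" if "l \<in> L" for l using that DK(4) by (auto simp: set_mult_def)
    then show "fst q \<subseteq> fst (K <#> L, \<rho>)" using CL by (auto simp: q_eq)
  qed (use DL(5) \<rho>L q_eq in auto)
  ultimately show thesis using that[of "(K <#> L, \<rho>)"] by (simp add: p_eq q_eq)
qed

text \<open>A character on KL is determined by its values on K and on L, so r is the least upper
  bound of p and q.\<close>

lemma pair_join_le_iff:
  assumes r: "r \<in> frattini_pairs G" "fst r = fst p <#> fst q" "pair_le p r" "pair_le q r"
    and s: "s \<in> frattini_pairs G"
  shows "pair_le r s \<longleftrightarrow> pair_le p s \<and> pair_le q s"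
proof
  assume "pair_le r s"
  then show "pair_le p s \<and> pair_le q s" using r pair_le_trans by blast
next
  assume le: "pair_le p s \<and> pair_le q s"
  note Ds = invariant_pairD[OF frattini_pairsD(1)[OF s]]
  note Dr = invariant_pairD[OF frattini_pairsD(1)[OF r(1)]]
  have sub: "fst p \<subseteq> fst s" "fst q \<subseteq> fst s" "fst p \<subseteq> fst r" "fst q \<subseteq> fst r"
    using le r by (auto simp: pair_le_def)
  show "pair_le r s"
  proof (rule pair_leI)
    show "fst r \<subseteq> fst s"
      using sub(1,2) subgroup.m_closed[OF Ds(2)] by (auto simp: r(2) set_mult_def subset_iff)
    show "snd r \<in> extensional (fst r)" by (rule Dr(5))
    fix x assume "x \<in> fst r"
    then obtain k l where kl: "k \<in> fst p" "l \<in> fst q" "x = k \<otimes> l"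
      by (auto simp: r(2) set_mult_def)
    then have "snd s x = snd s k * snd s l" "snd r x = snd r k * snd r l"
      using Ds(6)[of k l] Dr(6)[of k l] subsetD[OF sub(1)] subsetD[OF sub(2)]
        subsetD[OF sub(3)] subsetD[OF sub(4)] by simp_all
    then show "snd s x = snd r x"
      using kl le r pair_le_apply by metis
  qed
qed

lemma compatible_pairs_if_le:
  "pair_le p s \<Longrightarrow> pair_le q s \<Longrightarrow> compatible_pairs p q"
  unfolding compatible_pairs_def using pair_le_apply by (metis IntD1 IntD2)

text \<open>Below s the character of a pair is forced to be the restriction of that of s.
  Conversely, restricting it to any normal subgroup of G inside \<open>fst s\<close> gives a pair.
  So the interval is a copy of an interval of normal subgroups.\<close>

lemma sum_pair_interval:
  assumes p: "p \<in> frattini_pairs G" and s: "s \<in> frattini_pairs G" and le: "pair_le p s"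
  shows "(\<Sum>r\<in>{r \<in> frattini_pairs G. pair_le p r \<and> pair_le r s}. f (fst r)) =
    (\<Sum>M\<in>{M \<in> {N. N \<lhd> G}. fst p \<subseteq> M \<and> M \<subseteq> fst s}. f M)"
proof (rule sum.reindex_bij_witness[of _ "\<lambda>M. (M, restrict (snd s) M)" fst])
  fix r assume r: "r \<in> {r \<in> frattini_pairs G. pair_le p r \<and> pair_le r s}"
  then show "(fst r, restrict (snd s) (fst r)) = r" by (auto simp: pair_le_def prod_eq_iff)
  show "fst r \<in> {M \<in> {N. N \<lhd> G}. fst p \<subseteq> M \<and> M \<subseteq> fst s}"
    using r frattini_pairsD(4) by (auto simp: pair_le_def)
next
  fix M assume M: "M \<in> {M \<in> {N. N \<lhd> G}. fst p \<subseteq> M \<and> M \<subseteq> fst s}"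
  then have "(M, restrict (snd s) M) \<in> frattini_pairs G" using restrict_frattini_pair[OF s] by simp
  moreover have "pair_le p (M, restrict (snd s) M)" "pair_le (M, restrict (snd s) M) s"
    using M le by (auto simp: pair_le_def Int_absorb1)
  ultimately show "(M, restrict (snd s) M) \<in> {r \<in> frattini_pairs G. pair_le p r \<and> pair_le r s}"
    by simp
qed simp_all

text \<open>Both one-sided identities hold, so \<open>mu_normal\<close> on first components serves
  as the Moebius function of the poset of pairs.\<close>

lemma mu_normal_pair_sums:
  assumes fin: "finite (carrier G)"
    and p: "p \<in> frattini_pairs G" and s: "s \<in> frattini_pairs G" and le: "pair_le p s"
  shows "(\<Sum>r\<in>{r \<in> frattini_pairs G. pair_le p r \<and> pair_le r s}. mu_normal G (fst r) (fst s)) =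
      (if p = s then 1 else 0)"
    and "(\<Sum>r\<in>{r \<in> frattini_pairs G. pair_le p r \<and> pair_le r s}. mu_normal G (fst p) (fst r)) =
      (if p = s then 1 else 0)"
proof -
  have finN: "finite {N. N \<lhd> G}"
    using finite_subgroups[OF fin] by (rule rev_finite_subset) (auto intro: normal_imp_subgroup)
  have "finite (fst s)" using frattini_pairsD(6)[OF s] fin finite_subset by blast
  moreover have "p = s \<longleftrightarrow> fst p = fst s" using pair_le_fst_eq[OF le frattini_pairsD(3)[OF s]] by auto
  moreover have "fst p \<subseteq> fst s" using le by (simp add: pair_le_def)
  ultimately show
    "(\<Sum>r\<in>{r \<in> frattini_pairs G. pair_le p r \<and> pair_le r s}. mu_normal G (fst r) (fst s)) =
      (if p = s then 1 else 0)"
    "(\<Sum>r\<in>{r \<in> frattini_pairs G. pair_le p r \<and> pair_le r s}. mu_normal G (fst p) (fst r)) =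
      (if p = s then 1 else 0)"
    using moebius_sum_right[OF finN, of "fst p" "fst s"] moebius_sum_left[OF finN, of "fst p" "fst s"]
      frattini_pairsD(4)[OF p] frattini_pairsD(4)[OF s]
    unfolding sum_pair_interval[OF p s le, of "\<lambda>M. mu_normal G M (fst s)"]
      sum_pair_interval[OF p s le, of "mu_normal G (fst p)"]
    by (simp_all add: mu_normal_def)
qed

end

subsection \<open>The idempotents\<close>

text \<open>This is \<open>A p\<close> of the overview. The sum is restricted to X above the
  Frattini subgroup so that the product formula applies to each term.\<close>

definition frattini_elem :: "('a, 'm) monoid_scheme \<Rightarrow> 'a set \<times> ('a \<Rightarrow> complex)
    \<Rightarrow> (('a, 'a) fib_class \<Rightarrow>\<^sub>0 'k::{comm_ring,comm_monoid_mult})" where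
  "frattini_elem G p = scale (inv_order G)
     (\<Sum>X \<in> {X. subgroup X G \<and> frattini G \<subseteq> X}.
        scale (int_embed (mu_sub G X (carrier G))) (weighted_class G X p))"

lemma inv_order_mult:
  assumes "\<exists>c::'k::{comm_ring,comm_monoid_mult}. c * int_embed (int (order G)) = 1"
  shows "inv_order G * int_embed (int (order G)) = (1::'k)"
  unfolding inv_order_def
proof (rule theI')
  obtain c :: 'k where c: "c * int_embed (int (order G)) = 1" using assms by blast
  have "d = c" if d: "d * int_embed (int (order G)) = 1" for d :: 'k
  proof -
    have "d = d * (c * int_embed (int (order G)))" using c by simp
    also have "\<dots> = c * (d * int_embed (int (order G)))" by (rule mult.left_commute)
    finally show ?thesis using d by simp
  qed
  with c show "\<exists>!c::'k. c * int_embed (int (order G)) = 1" by blast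
qed

context group begin

text \<open>The omitted coefficients vanish by \<open>mu_sub_eq_0\<close>. This gives access to the
  full subgroup lattice for Weisner's theorem and for the comparison with
  \<open>e_tilde\<close>.\<close>

lemma sum_over_frattini:
  fixes F :: "'a set \<Rightarrow> ('c \<Rightarrow>\<^sub>0 'k::{comm_ring,comm_monoid_mult})"
  assumes fin: "finite (carrier G)"
  shows "(\<Sum>X\<in>{X. subgroup X G \<and> frattini G \<subseteq> X}. scale (int_embed (mu_sub G X (carrier G))) (F X)) =
    (\<Sum>X\<in>{X. subgroup X G}. scale (int_embed (mu_sub G X (carrier G))) (F X))"
  using finite_subgroups[OF fin] mu_sub_eq_0[OF fin] by (intro sum.mono_neutral_left) auto

lemma conj_set_carrier: "x \<in> carrier G \<Longrightarrow> conj_set G x (carrier G) = carrier G"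
  by (rule conj_set_self[OF subgroup_self])

text \<open>After exchanging the sums, w is fixed and X varies: for proper Y the inner sum is a
  Moebius sum over meets with a fixed proper subgroup. For Y = G each w reproduces the sum defining
  \<open>frattini_elem G r\<close>.\<close>

lemma frattini_elem_mult_weighted_class:
  assumes fin: "finite (carrier G)"
    and p: "p \<in> frattini_pairs G" and q: "q \<in> frattini_pairs G" and r: "r \<in> frattini_pairs G"
    and r_eq: "fst r = fst p <#> fst q" and le: "pair_le p r" "pair_le q r"
    and Y: "subgroup Y G" "frattini G \<subseteq> Y"
  shows "fib_mult G (frattini_elem G p) (weighted_class G Y q) =
    (if Y = carrier G then scale (int_embed (int (order G))) (frattini_elem G r)
     else 0 :: _ \<Rightarrow>\<^sub>0 'k::{comm_ring,comm_monoid_mult})"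
proof -
  let ?S = "{X. subgroup X G \<and> frattini G \<subseteq> X}"
  let ?m = "\<lambda>X. int_embed (mu_sub G X (carrier G)) :: 'k"
  have "fib_mult G (frattini_elem G p) (weighted_class G Y q :: _ \<Rightarrow>\<^sub>0 'k) =
    scale (inv_order G) (\<Sum>X\<in>?S. scale (?m X) (fib_mult G (weighted_class G X p) (weighted_class G Y q)))"
    unfolding frattini_elem_def by (simp add: fib_comp_scale_left fib_comp_sum_left)
  also have "\<dots> = scale (inv_order G) (\<Sum>X\<in>?S. \<Sum>w\<in>carrier G.
      scale (?m X) (weighted_class G (X \<inter> conj_set G w Y) r))"
    by (intro arg_cong[of _ _ "scale (inv_order G)"] sum.cong refl)
       (simp add: weighted_class_mult[OF fin p q r r_eq le _ _ Y] scale_sum)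
  also have "\<dots> = scale (inv_order G) (\<Sum>w\<in>carrier G. \<Sum>X\<in>?S.
      scale (?m X) (weighted_class G (X \<inter> conj_set G w Y) r))"
    by (subst sum.swap) simp
  also have "\<dots> = (if Y = carrier G then scale (int_embed (int (order G))) (frattini_elem G r) else 0)"
  proof (cases "Y = carrier G")
    case True
    have "(\<Sum>w\<in>carrier G. \<Sum>X\<in>?S. scale (?m X) (weighted_class G (X \<inter> conj_set G w Y) r)) =
      (\<Sum>w\<in>carrier G. \<Sum>X\<in>?S. scale (?m X) (weighted_class G X r))"
      using True by (intro sum.cong refl) (simp add: conj_set_carrier Int_absorb2 subgroup.subset)
    then show ?thesis
      using True by (simp add: sum_const_scale order_def frattini_elem_def scale_commute)
  next
    case False
    have "(\<Sum>X\<in>?S. scale (?m X) (weighted_class G (X \<inter> conj_set G w Y) r)) = 0"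
      if w: "w \<in> carrier G" for w
    proof -
      have Z: "subgroup (conj_set G w Y) G" by (rule subgroup_conj_set[OF w Y(1)])
      have "conj_set G w Y \<noteq> carrier G"
      proof
        assume "conj_set G w Y = carrier G"
        then have "card Y = card (carrier G)"
          using card_conj_set[OF w subgroup.subset[OF Y(1)]] by simp
        then show False using False card_subset_eq[OF fin subgroup.subset[OF Y(1)]] by simp
      qed
      then show ?thesis
        unfolding sum_over_frattini[OF fin] unfolding mu_sub_def
        using finite_subgroups[OF fin] subgroup_self fin Z
        by (intro moebius_sum_meet) (auto dest: subgroup.subset intro: subgroups_Inter_pair)
    qed
    then show ?thesis using False by simp
  qed
  finally show ?thesis .
qed

text \<open>Only Y = G survives in the second factor, with Moebius coefficient 1; the resulting |G|
  cancels against \<open>inv_order G\<close>.\<close>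

lemma frattini_elem_mult:
  assumes fin: "finite (carrier G)"
    and inv: "\<exists>c::'k::{comm_ring,comm_monoid_mult}. c * int_embed (int (order G)) = 1"
    and p: "p \<in> frattini_pairs G" and q: "q \<in> frattini_pairs G" and r: "r \<in> frattini_pairs G"
    and r_eq: "fst r = fst p <#> fst q" and le: "pair_le p r" "pair_le q r"
  shows "fib_mult G (frattini_elem G p) (frattini_elem G q) = (frattini_elem G r :: _ \<Rightarrow>\<^sub>0 'k)"
proof -
  let ?S = "{X. subgroup X G \<and> frattini G \<subseteq> X}"
  let ?m = "\<lambda>X. int_embed (mu_sub G X (carrier G)) :: 'k"
  let ?R = "scale (int_embed (int (order G))) (frattini_elem G r) :: _ \<Rightarrow>\<^sub>0 'k"
  have finS: "finite ?S" using finite_subgroups[OF fin] by simp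
  have C: "carrier G \<in> ?S" by (simp add: subgroup_self frattini_def)
  have "fib_mult G (frattini_elem G p) (frattini_elem G q :: _ \<Rightarrow>\<^sub>0 'k) = scale (inv_order G)
      (\<Sum>Y\<in>?S. scale (?m Y) (fib_mult G (frattini_elem G p) (weighted_class G Y q)))"
    unfolding frattini_elem_def[of G q] by (simp add: fib_comp_scale_right fib_comp_sum_right)
  also have "(\<Sum>Y\<in>?S. scale (?m Y) (fib_mult G (frattini_elem G p) (weighted_class G Y q))) =
      (\<Sum>Y\<in>?S. if Y = carrier G then scale (?m Y) ?R else 0)"
    by (intro sum.cong refl) (simp add: frattini_elem_mult_weighted_class[OF fin p q r r_eq le])
  also have "\<dots> = ?R" using finS C by (simp add: mu_sub_def)
  finally show ?thesis by (simp add: scale_scale inv_order_mult[OF inv])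
qed

lemma frattini_elem_mult_incompatible:
  assumes "p \<in> frattini_pairs G" "q \<in> frattini_pairs G" "\<not> compatible_pairs p q"
  shows "fib_mult G (frattini_elem G p) (frattini_elem G q) = 0"
  unfolding frattini_elem_def
  by (simp add: fib_comp_scale_left fib_comp_sum_left fib_comp_scale_right fib_comp_sum_right
      weighted_class_mult_incompatible[OF assms])

text \<open>With K trivial the condition h^-1 g \<in> K means g = h, so the twisted diagonal is the
  ordinary one. The terms of \<open>e_tilde\<close> not above the Frattini subgroup have coefficient
  zero.\<close>

lemma e_tilde_eq:
  assumes fin: "finite (carrier G)"
  shows "e_tilde G = frattini_elem G (trivial_pair G)"
proof -
  have basis: "fib_basis G G (diag X) (\<lambda>u\<in>diag X. 1) =
      Poly_Mapping.single (twisted_class G X (fst (trivial_pair G)) (snd (trivial_pair G))) 1"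
    if X: "subgroup X G" for X
  proof -
    have XC: "X \<subseteq> carrier G" by (rule subgroup.subset[OF X])
    have eq: "inv h \<otimes> g = \<one> \<longleftrightarrow> g = h" if "g \<in> carrier G" "h \<in> carrier G" for g h
      using that by (metis inv_cancel_left(2) l_inv r_one)
    have set: "diag X = twisted_diag G \<one> \<one> X {\<one>}"
      using XC by (auto simp: diag_def twisted_diag_def eq)
    have "(\<lambda>u\<in>diag X. 1) = twisted_char G \<one> \<one> X {\<one>} (\<lambda>x\<in>{\<one>}. 1)"
      unfolding twisted_char_def by (rule restrict_cong_set[OF set]) (auto simp: twisted_diag_def)
    with set show ?thesis
      by (simp add: fib_basis_def trivial_pair_def fib_class_twisted)
  qed
  show ?thesis
    unfolding e_tilde_def frattini_elem_def sum_over_frattini[OF fin]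
    by (intro arg_cong[of _ _ "scale (inv_order G)"] sum.cong refl)
       (simp add: basis weighted_class_def scale_scale int_embed_mult mult.commute)
qed

lemma l_coset_eq_iff:
  assumes L: "subgroup L G" and gh: "g \<in> carrier G" "h \<in> carrier G"
  shows "g <# L = h <# L \<longleftrightarrow> inv h \<otimes> g \<in> L"
proof
  assume "g <# L = h <# L"
  moreover have "g \<otimes> \<one> \<in> g <# L" using subgroup.one_closed[OF L] unfolding l_coset_def by blast
  ultimately obtain l where l: "l \<in> L" "g = h \<otimes> l" using gh by (auto simp: l_coset_def)
  then show "inv h \<otimes> g \<in> L" using gh subgroup.mem_carrier[OF L] by simp
next
  assume m: "inv h \<otimes> g \<in> L"
  have m': "inv g \<otimes> h \<in> L" using subgroup.m_inv_closed[OF L m] gh by (simp add: inv_mult_group)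
  note C = subgroup.mem_carrier[OF L]
  have "g \<otimes> l = h \<otimes> ((inv h \<otimes> g) \<otimes> l)" "h \<otimes> l = g \<otimes> ((inv g \<otimes> h) \<otimes> l)" if "l \<in> L" for l
    using gh C[OF that] by (simp_all add: m_assoc)
  then show "g <# L = h <# L"
    using subgroup.m_closed[OF L m] subgroup.m_closed[OF L m'] unfolding l_coset_def by blast
qed

lemma e_pair_eq:
  assumes "q \<in> frattini_pairs G"
  shows "e_pair G q = Poly_Mapping.single (twisted_class G (carrier G) (fst q) (snd q)) 1"
proof -
  obtain L \<Lambda> where q: "q = (L, \<Lambda>)" by (cases q)
  have L: "subgroup L G" using frattini_pairsD(5)[OF assms] q by simp
  have set: "diag_mod G L = twisted_diag G \<one> \<one> (carrier G) L"
    unfolding diag_mod_def twisted_diag_def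
    by (intro Collect_cong) (clarsimp simp: l_coset_eq_iff[OF L] cong: conj_cong)
  have "(\<lambda>(g, h)\<in>diag_mod G L. \<Lambda> (inv h \<otimes> g)) = twisted_char G \<one> \<one> (carrier G) L \<Lambda>"
    unfolding twisted_char_def by (rule restrict_cong_set[OF set]) (auto simp: twisted_diag_def)
  with set show ?thesis by (simp add: e_pair_def q fib_basis_def fib_class_twisted)
qed

lemma e_pair_in_fib_module:
  assumes q: "q \<in> frattini_pairs G"
  shows "e_pair G q \<in> fib_module G G"
proof -
  obtain L \<Lambda> where q_eq: "q = (L, \<Lambda>)" by (cases q)
  have inv_L: "invariant_pair G L \<Lambda>" using frattini_pairsD(1)[OF q] q_eq by simp
  note D = invariant_pairD[OF inv_L]
  let ?U = "twisted_diag G \<one> \<one> (carrier G) L" and ?u = "twisted_char G \<one> \<one> (carrier G) L \<Lambda>"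
  have U: "?U = {(g, h). g \<in> carrier G \<and> h \<in> carrier G \<and> inv h \<otimes> g \<in> L}"
    by (auto simp: twisted_diag_def)
  have u: "?u (g, h) = \<Lambda> (inv h \<otimes> g)" if "(g, h) \<in> ?U" for g h
    using that by (auto simp: twisted_char_def twisted_diag_def)
  \<comment> \<open>This identity makes the twisted diagonal closed under products and its character
    multiplicative: conjugation by h'^-1 preserves L and the values of its character.\<close>
  have prod: "inv (h \<otimes> h') \<otimes> (g \<otimes> g') = conj_elt G (inv h') (inv h \<otimes> g) \<otimes> (inv h' \<otimes> g')"
    if "g \<in> carrier G" "h \<in> carrier G" "g' \<in> carrier G" "h' \<in> carrier G" for g h g' h'
    using that by (simp add: conj_elt_def m_assoc inv_mult_group)
  have mult: "(g \<otimes> g', h \<otimes> h') \<in> ?U" "?u (g \<otimes> g', h \<otimes> h') = ?u (g, h) * ?u (g', h')"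
    if gh: "(g, h) \<in> ?U" and gh': "(g', h') \<in> ?U" for g h g' h'
  proof -
    have C: "g \<in> carrier G" "h \<in> carrier G" "g' \<in> carrier G" "h' \<in> carrier G"
      and m: "inv h \<otimes> g \<in> L" "inv h' \<otimes> g' \<in> L"
      using gh gh' by (auto simp: U)
    have m': "conj_elt G (inv h') (inv h \<otimes> g) \<in> L" using normal_conj_elt_iff[OF D(1)] C m by simp
    then have "inv (h \<otimes> h') \<otimes> (g \<otimes> g') \<in> L"
      using prod[OF C] m subgroup.m_closed[OF D(2)] by simp
    then show U': "(g \<otimes> g', h \<otimes> h') \<in> ?U" using C by (simp add: U)
    show "?u (g \<otimes> g', h \<otimes> h') = ?u (g, h) * ?u (g', h')"
      unfolding u[OF gh] u[OF gh'] u[OF U'] prod[OF C] D(6)[OF m' m(2)]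
      using D(10)[OF _ m(1), of "inv h'"] C by simp
  qed
  have inv_in: "(inv g, inv h) \<in> ?U" if gh: "(g, h) \<in> ?U" for g h
  proof -
    have C: "g \<in> carrier G" "h \<in> carrier G" and m: "inv h \<otimes> g \<in> L" using gh by (auto simp: U)
    have "inv (inv h \<otimes> g) \<in> L" using m by (rule subgroup.m_inv_closed[OF D(2)])
    then have "conj_elt G h (inv (inv h \<otimes> g)) \<in> L" using normal_conj_elt_iff[OF D(1)] C by simp
    moreover have "conj_elt G h (inv (inv h \<otimes> g)) = inv (inv h) \<otimes> inv g"
      using C by (simp add: conj_elt_def inv_mult_group m_assoc)
    ultimately show ?thesis using C by (simp add: U)
  qed
  interpret GG: group "G \<times>\<times> G" by (rule DirProd_group[OF is_group is_group])
  have "subgroup ?U (G \<times>\<times> G)"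
  proof (rule GG.subgroupI)
    show "?U \<subseteq> carrier (G \<times>\<times> G)" by (auto simp: U)
    have "(\<one>, \<one>) \<in> ?U" using D(4) by (simp add: U)
    then show "?U \<noteq> {}" by blast
    fix a assume a: "a \<in> ?U"
    obtain g h where gh: "a = (g, h)" by (cases a)
    then show "inv\<^bsub>G \<times>\<times> G\<^esub> a \<in> ?U" using inv_in a by (auto simp: U inv_DirProd is_group)
    fix b assume "b \<in> ?U"
    then show "a \<otimes>\<^bsub>G \<times>\<times> G\<^esub> b \<in> ?U" using mult(1) a gh by (cases b) simp
  qed
  moreover have "?u \<in> dual (G \<times>\<times> G) ?U"
  proof -
    have "?u x \<noteq> 0" if "x \<in> ?U" for x using that u D(7) by (cases x) (auto simp: U)
    moreover have "?u (x \<otimes>\<^bsub>G \<times>\<times> G\<^esub> y) = ?u x * ?u y" if "x \<in> ?U" "y \<in> ?U" for x y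
      using that mult(2) by (cases x, cases y) simp
    ultimately have "?u \<in> hom ((G \<times>\<times> G)\<lparr>carrier := ?U\<rparr>) Cx" by (simp add: hom_def Cx_def)
    then show ?thesis by (simp add: dual_def twisted_char_def)
  qed
  ultimately have "(?U, ?u) \<in> char_pairs (G \<times>\<times> G)" by (simp add: char_pairs_def)
  then have "twisted_class G (carrier G) L \<Lambda> \<in> fib_classes G G"
    unfolding fib_classes_def using fib_class_twisted[of \<one> \<one> "carrier G" L \<Lambda>] by force
  then show ?thesis unfolding e_pair_eq[OF q] fib_module_def by (simp add: q_eq)
qed

text \<open>\<open>e_pair G q\<close> is 1/|G| times the weighted class of X = G, the only one not
  annihilated by \<open>e_tilde\<close>. The join of q with the trivial pair, on either side, is
  q.\<close>

lemma frattini_elem_sandwich: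
  assumes fin: "finite (carrier G)"
    and inv: "\<exists>c::'k::{comm_ring,comm_monoid_mult}. c * int_embed (int (order G)) = 1"
    and q: "q \<in> frattini_pairs G"
  shows "fib_mult G (fib_mult G (e_tilde G) (e_pair G q)) (e_tilde G) = (frattini_elem G q :: _ \<Rightarrow>\<^sub>0 'k)"
proof -
  note D = frattini_pairsD[OF q]
  note triv = trivial_pair_in trivial_pair_le[OF q] pair_le_refl[OF D(3)]
  have 1: "fst q = fst (trivial_pair G) <#> fst q" "fst q = fst q <#> fst (trivial_pair G)"
    using D(6) by (force simp: trivial_pair_def set_mult_def)+
  have "e_pair G q = scale (inv_order G) (weighted_class G (carrier G) q :: _ \<Rightarrow>\<^sub>0 'k)"
    using inv_order_mult[OF inv]
    by (simp add: e_pair_eq[OF q] weighted_class_def scale_scale flip: order_def)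
  then have "fib_mult G (e_tilde G) (e_pair G q) =
      scale (inv_order G) (scale (int_embed (int (order G))) (frattini_elem G q :: _ \<Rightarrow>\<^sub>0 'k))"
    by (simp add: e_tilde_eq[OF fin] fib_comp_scale_right frattini_def
        frattini_elem_mult_weighted_class[OF fin triv(1) q q 1(1) triv(2,3) subgroup_self])
  also have "\<dots> = frattini_elem G q" by (simp add: scale_scale inv_order_mult[OF inv])
  finally show ?thesis
    using frattini_elem_mult[OF fin inv q triv(1) q 1(2) triv(3,2)] by (simp add: e_tilde_eq[OF fin])
qed

text \<open>By bilinearity the sum moves inside the two factors \<open>e_tilde\<close>.\<close>

lemma phi_in_E_algebra:
  "(phi G p :: _ \<Rightarrow>\<^sub>0 'k::{comm_ring,comm_monoid_mult}) \<in> E_algebra G"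
proof -
  let ?b = "\<Sum>q\<in>{q \<in> frattini_pairs G. pair_le p q}.
    scale (int_embed (mu_normal G (fst p) (fst q))) (e_pair G q :: _ \<Rightarrow>\<^sub>0 'k)"
  have "?b \<in> fib_module G G"
    by (intro fib_module_sum fib_module_scale e_pair_in_fib_module) simp
  moreover have "phi G p = fib_mult G (fib_mult G (e_tilde G) ?b) (e_tilde G)"
    by (simp add: phi_def fib_comp_sum_left fib_comp_sum_right fib_comp_scale_left
        fib_comp_scale_right)
  ultimately show ?thesis unfolding E_algebra_def by blast
qed

section \<open>Moebius inversion and orthogonality\<close>

context
  assumes fin: "finite (carrier G)"
    and inv: "\<exists>c::'k::{comm_ring,comm_monoid_mult}. c * int_embed (int (order G)) = 1"
begin

lemma phi_eq:
  "(phi G p :: _ \<Rightarrow>\<^sub>0 'k) = (\<Sum>q\<in>{q \<in> frattini_pairs G. pair_le p q}.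
    scale (int_embed (mu_normal G (fst p) (fst q))) (frattini_elem G q))"
  unfolding phi_def by (intro sum.cong refl) (simp add: frattini_elem_sandwich[OF fin inv])

text \<open>Moebius inversion: after exchanging the sums, the coefficient at s is the sum of mu(r,
  s) over p \<le> r \<le> s, which is 1 for s = p and 0 otherwise.\<close>

lemma frattini_elem_eq_sum_phi:
  assumes p: "p \<in> frattini_pairs G"
  shows "(frattini_elem G p :: _ \<Rightarrow>\<^sub>0 'k) = (\<Sum>r\<in>{r \<in> frattini_pairs G. pair_le p r}. phi G r)"
proof -
  let ?A = "{r \<in> frattini_pairs G. pair_le p r}"
  let ?f = "\<lambda>r s. scale (int_embed (mu_normal G (fst r) (fst s))) (frattini_elem G s :: _ \<Rightarrow>\<^sub>0 'k)"
  have finA: "finite ?A" using finite_frattini_pairs[OF fin] by simp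
  have pA: "p \<in> ?A" using p pair_le_refl frattini_pairsD(3) by blast
  have "(\<Sum>r\<in>?A. phi G r :: _ \<Rightarrow>\<^sub>0 'k) = (\<Sum>r\<in>?A. \<Sum>s\<in>{s \<in> ?A. pair_le r s}. ?f r s)"
    by (intro sum.cong refl) (auto simp: phi_eq intro!: sum.cong intro: pair_le_trans)
  also have "\<dots> = (\<Sum>s\<in>?A. \<Sum>r\<in>{r \<in> ?A. pair_le r s}. ?f r s)"
    using finA by (rule sum.swap_restrict[OF _ finA])
  also have "\<dots> = (\<Sum>s\<in>?A. if p = s then frattini_elem G s else 0)"
  proof (intro sum.cong refl)
    fix s assume s: "s \<in> ?A"
    have "{r \<in> ?A. pair_le r s} = {r \<in> frattini_pairs G. pair_le p r \<and> pair_le r s}" by auto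
    then have "(\<Sum>r\<in>{r \<in> ?A. pair_le r s}. ?f r s) =
      scale (int_embed (\<Sum>r\<in>{r \<in> frattini_pairs G. pair_le p r \<and> pair_le r s}.
        mu_normal G (fst r) (fst s))) (frattini_elem G s)"
      by (simp only: int_embed_sum scale_sum_left)
    then show "(\<Sum>r\<in>{r \<in> ?A. pair_le r s}. ?f r s) = (if p = s then frattini_elem G s else 0)"
      using mu_normal_pair_sums(1)[OF fin p, of s] s by simp
  qed
  also have "\<dots> = frattini_elem G p" using finA pA by simp
  finally show ?thesis by simp
qed

text \<open>One formula covers both cases: the common upper bounds of compatible pairs are the pairs
  above the join, while incompatible pairs have none and product zero.\<close>

lemma frattini_elem_mult_eq_sum_phi:
  assumes p: "p \<in> frattini_pairs G" and q: "q \<in> frattini_pairs G"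
  shows "fib_mult G (frattini_elem G p) (frattini_elem G q :: _ \<Rightarrow>\<^sub>0 'k) =
    (\<Sum>r\<in>{r \<in> frattini_pairs G. pair_le p r \<and> pair_le q r}. phi G r)"
proof (cases "compatible_pairs p q")
  case True
  then obtain r where r: "r \<in> frattini_pairs G" "fst r = fst p <#> fst q" "pair_le p r" "pair_le q r"
    using pair_join_exists[OF p q] by metis
  have "{s \<in> frattini_pairs G. pair_le r s} =
      {s \<in> frattini_pairs G. pair_le p s \<and> pair_le q s}"
    using pair_join_le_iff[OF r] by auto
  then show ?thesis
    using frattini_elem_mult[OF fin inv p q r] frattini_elem_eq_sum_phi[OF r(1)] by simp
next
  case False
  then have none: "{r \<in> frattini_pairs G. pair_le p r \<and> pair_le q r} = {}"
    using compatible_pairs_if_le by blast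
  show ?thesis unfolding none using frattini_elem_mult_incompatible[OF p q False] by simp
qed

text \<open>Induction from the top of the poset: expand \<open>frattini_elem G p\<close> as the sum of the
  \<open>phi G r\<close> with \<open>r \<ge> p\<close> and compare the product with the sum over the common upper bounds
  of \<open>p\<close> and \<open>q\<close>.\<close>

lemma phi_mult_frattini_elem:
  assumes "p \<in> frattini_pairs G" and q: "q \<in> frattini_pairs G"
  shows "fib_mult G (phi G p) (frattini_elem G q :: _ \<Rightarrow>\<^sub>0 'k) = (if pair_le q p then phi G p else 0)"
  using assms(1)
proof (induction "card (carrier G) - card (fst p)" arbitrary: p rule: less_induct)
  case (less p)
  note p = less.prems
  let ?A = "{r \<in> frattini_pairs G. pair_le p r}"
  let ?g = "\<lambda>r. if pair_le q r then phi G r else 0 :: _ \<Rightarrow>\<^sub>0 'k"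
  have finA: "finite ?A" using finite_frattini_pairs[OF fin] by simp
  have pA: "p \<in> ?A" using p pair_le_refl frattini_pairsD(3) by blast
  have IH: "fib_mult G (phi G r) (frattini_elem G q) = ?g r" if r: "r \<in> ?A - {p}" for r
  proof -
    have r': "r \<in> frattini_pairs G" "pair_le p r" using r by auto
    have "fst p \<noteq> fst r" using pair_le_fst_eq[OF r'(2) frattini_pairsD(3)[OF r'(1)]] r by auto
    then have "fst p \<subset> fst r" using r'(2) by (auto simp: pair_le_def)
    moreover have rC: "fst r \<subseteq> carrier G" by (rule frattini_pairsD(6)[OF r'(1)])
    ultimately have "card (fst p) < card (fst r)" "card (fst r) \<le> card (carrier G)"
      using fin finite_subset[OF rC fin] by (auto intro: psubset_card_mono card_mono)
    then show ?thesis using less.hyps[of r] r' by simp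
  qed
  have "?g p + (\<Sum>r\<in>?A - {p}. ?g r) = (\<Sum>r\<in>?A. ?g r)"
    using finA pA by (rule sum.remove[symmetric])
  also have "\<dots> = (\<Sum>r\<in>{r \<in> ?A. pair_le q r}. phi G r)"
    using finA by (rule sum.inter_filter[symmetric])
  also have "\<dots> = (\<Sum>r\<in>{r \<in> frattini_pairs G. pair_le p r \<and> pair_le q r}. phi G r)"
    by (intro sum.cong) auto
  also have "\<dots> = fib_mult G (frattini_elem G p) (frattini_elem G q)"
    by (simp only: frattini_elem_mult_eq_sum_phi[OF p q])
  also have "\<dots> = (\<Sum>r\<in>?A. fib_mult G (phi G r) (frattini_elem G q))"
    unfolding frattini_elem_eq_sum_phi[OF p] fib_comp_sum_left ..
  also have "\<dots> = fib_mult G (phi G p) (frattini_elem G q) +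
      (\<Sum>r\<in>?A - {p}. fib_mult G (phi G r) (frattini_elem G q))"
    using finA pA by (rule sum.remove)
  also have "(\<Sum>r\<in>?A - {p}. fib_mult G (phi G r) (frattini_elem G q)) = (\<Sum>r\<in>?A - {p}. ?g r)"
    using IH by (intro sum.cong refl)
  finally show ?case by simp
qed

text \<open>Only the second factor is expanded. Multiplication by \<open>phi G p\<close> keeps the s
  with q \<le> s \<le> p, and the sum of their coefficients mu(q, s) is 1 for p = q and 0
  otherwise.\<close>

lemma phi_mult_phi:
  assumes p: "p \<in> frattini_pairs G" and q: "q \<in> frattini_pairs G"
  shows "fib_mult G (phi G p) (phi G q :: _ \<Rightarrow>\<^sub>0 'k) = (if p = q then phi G p else 0)"
proof -
  let ?B = "{s \<in> frattini_pairs G. pair_le q s}"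
  let ?c = "\<lambda>s. int_embed (mu_normal G (fst q) (fst s)) :: 'k"
  have finB: "finite ?B" using finite_frattini_pairs[OF fin] by simp
  have "fib_mult G (phi G p) (phi G q :: _ \<Rightarrow>\<^sub>0 'k) =
      (\<Sum>s\<in>?B. scale (?c s) (fib_mult G (phi G p) (frattini_elem G s)))"
    unfolding phi_eq[of q] by (simp add: fib_comp_sum_right fib_comp_scale_right)
  also have "\<dots> = (\<Sum>s\<in>?B. if pair_le s p then scale (?c s) (phi G p) else 0)"
    by (intro sum.cong refl) (simp add: phi_mult_frattini_elem[OF p])
  also have "\<dots> = (\<Sum>s\<in>{s \<in> ?B. pair_le s p}. scale (?c s) (phi G p))"
    using finB by (rule sum.inter_filter[symmetric])
  also have "{s \<in> ?B. pair_le s p} = {s \<in> frattini_pairs G. pair_le q s \<and> pair_le s p}" by auto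
  also have "(\<Sum>s\<in>\<dots>. scale (?c s) (phi G p)) =
    scale (int_embed (\<Sum>s\<in>{s \<in> frattini_pairs G. pair_le q s \<and> pair_le s p}.
      mu_normal G (fst q) (fst s))) (phi G p)"
    by (simp add: int_embed_sum scale_sum_left)
  also have "\<dots> = (if p = q then phi G p else 0)"
  proof (cases "pair_le q p")
    case True
    then show ?thesis using mu_normal_pair_sums(2)[OF fin q p] by auto
  next
    case False
    then have none: "{s \<in> frattini_pairs G. pair_le q s \<and> pair_le s p} = {}"
      using pair_le_trans by blast
    have "p \<noteq> q" using False pair_le_refl[OF frattini_pairsD(3)[OF p]] by blast
    then show ?thesis unfolding none by simp
  qed
  finally show ?thesis .
qed

text \<open>The trivial pair is the bottom of the poset, so the inversion formula at that pair runs
  over all pairs.\<close>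

lemma sum_phi: "(\<Sum>p\<in>frattini_pairs G. phi G p) = (e_tilde G :: _ \<Rightarrow>\<^sub>0 'k)"
proof -
  have "{r \<in> frattini_pairs G. pair_le (trivial_pair G) r} = frattini_pairs G"
    using trivial_pair_le by auto
  then show ?thesis
    using frattini_elem_eq_sum_phi[OF trivial_pair_in] by (simp add: e_tilde_eq[OF fin])
qed

end

end

theorem theorem3p12:
  fixes G :: "('a, 'm) monoid_scheme"
  assumes "group G"
    and "finite (carrier G)"
    and "\<exists>c::'k::{comm_ring,comm_monoid_mult}. c * int_embed (int (order G)) = 1"
  shows "(\<forall>p \<in> frattini_pairs G.
            (phi G p :: ('a, 'a) fib_class \<Rightarrow>\<^sub>0 'k) \<in> E_algebra G) \<and>
         (\<forall>p \<in> frattini_pairs G. \<forall>q \<in> frattini_pairs G.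
            fib_mult G (phi G p) (phi G q :: ('a, 'a) fib_class \<Rightarrow>\<^sub>0 'k) =
              (if p = q then phi G p else 0)) \<and>
         (\<Sum>p \<in> frattini_pairs G. (phi G p :: ('a, 'a) fib_class \<Rightarrow>\<^sub>0 'k)) = e_tilde G"
proof -
  interpret group G by (rule assms(1))
  show ?thesis
    using phi_in_E_algebra phi_mult_phi[OF assms(2,3)] sum_phi[OF assms(2,3)] by blast
qed

end
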